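(* There is a constant $\delta>0$ such that for each $n\in\mathbb{N}$ there is a symmetric convex body $K$ in $\mathbb{R}^n$ satisfying $$|P_\theta K| \ge \delta\sqrt{n}\,|K|^{\frac{n-1}{n}}$$ for every unit vector $\theta\in\mathbb{R}^n$.
   Context: A convex body in $\mathbb{R}^n$ is a compact convex set with non-empty interior; it is symmetric if $K=-K$. Unit vectors are taken with respect to the Euclidean norm. For a unit vector $\theta$, $P_\theta$ denotes the orthogonal projection of $\mathbb{R}^n$ onto the $1$-codimensional subspace perpendicular to $\theta$. $|\cdot|$ applied to a set denotes volume of the appropriate dimension: $|K|$ is $n$-dimensional volume and $|P_\theta K|$ is $(n-1)$-dimensional volume in the hyperplane $\theta^\perp$. The constant $\delta$ does not depend on $n$. *)

theory Defs
  imports "HOL-Analysis.Analysis"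
begin

text \<open>
  Since the constant in the statement must not depend on the dimension, the dimension is a natural
  number and not a type: n-dimensional space is \<^term>\<open>topspace (Euclidean_space n)\<close>, the set of all
  \<^term>\<open>x :: nat \<Rightarrow> real\<close> that vanish at every index at least \<^term>\<open>n\<close>, with its Euclidean topology.
  As \<^typ>\<open>nat \<Rightarrow> real\<close> is not an instance of \<^class>\<open>real_vector\<close>, the linear notions are written
  out coordinatewise.
\<close>

definition dot :: "nat \<Rightarrow> (nat \<Rightarrow> real) \<Rightarrow> (nat \<Rightarrow> real) \<Rightarrow> real"
  where "dot n x y = (\<Sum>i<n. x i * y i)"

definition unit_vector :: "nat \<Rightarrow> (nat \<Rightarrow> real) \<Rightarrow> bool"
  where "unit_vector n \<theta> \<longleftrightarrow> \<theta> \<in> topspace (Euclidean_space n) \<and> sqrt (dot n \<theta> \<theta>) = 1"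

definition convex_set :: "(nat \<Rightarrow> real) set \<Rightarrow> bool"
  where "convex_set K \<longleftrightarrow>
    (\<forall>x\<in>K. \<forall>y\<in>K. \<forall>s\<ge>0. \<forall>t\<ge>0. s + t = 1 \<longrightarrow> (\<lambda>i. s * x i + t * y i) \<in> K)"

definition convex_body :: "nat \<Rightarrow> (nat \<Rightarrow> real) set \<Rightarrow> bool"
  where "convex_body n K \<longleftrightarrow>
    compactin (Euclidean_space n) K \<and> convex_set K \<and> Euclidean_space n interior_of K \<noteq> {}"

definition symmetric_set :: "(nat \<Rightarrow> real) set \<Rightarrow> bool"
  where "symmetric_set K \<longleftrightarrow> (\<lambda>x i. - x i) ` K = K"

text \<open>
  The n-dimensional Lebesgue measure lives on functions with index set \<^term>\<open>{..<n}\<close>. In dimension 0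
  it gives the one-point space measure 1.
\<close>

definition vol :: "nat \<Rightarrow> (nat \<Rightarrow> real) set \<Rightarrow> real"
  where "vol n A = measure (\<Pi>\<^sub>M i\<in>{..<n}. lborel) ((\<lambda>x. restrict x {..<n}) ` A)"

definition hyperplane :: "nat \<Rightarrow> (nat \<Rightarrow> real) \<Rightarrow> (nat \<Rightarrow> real) set"
  where "hyperplane n \<theta> = {x \<in> topspace (Euclidean_space n). dot n x \<theta> = 0}"

definition proj :: "nat \<Rightarrow> (nat \<Rightarrow> real) \<Rightarrow> (nat \<Rightarrow> real) \<Rightarrow> (nat \<Rightarrow> real)"
  where "proj n \<theta> x = (\<lambda>i. x i - dot n x \<theta> * \<theta> i)"

text \<open>
  For \<^term>\<open>\<theta> \<noteq> (\<lambda>_. 0)\<close> the hyperplane has dimension \<^term>\<open>n - 1\<close>, so \<^term>\<open>n - 1\<close> orthonormal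
  vectors in it automatically span it.
\<close>

definition orthonormal_basis_of_hyperplane :: "nat \<Rightarrow> (nat \<Rightarrow> real) \<Rightarrow> (nat \<Rightarrow> nat \<Rightarrow> real) \<Rightarrow> bool"
  where "orthonormal_basis_of_hyperplane n \<theta> u \<longleftrightarrow>
    (\<forall>j<n-1. u j \<in> hyperplane n \<theta>) \<and>
    (\<forall>j<n-1. \<forall>k<n-1. dot n (u j) (u k) = (if j = k then 1 else 0))"

text \<open>
  The (n-1)-dimensional volume of a subset of the hyperplane is the Lebesgue measure of its set of
  coordinate vectors with respect to an orthonormal basis. Two such bases differ by an orthogonal
  transformation of the coordinates, so the choice of the basis does not matter; that there is one
  is shown below.
\<close>

definition hyperplane_vol :: "nat \<Rightarrow> (nat \<Rightarrow> real) \<Rightarrow> (nat \<Rightarrow> real) set \<Rightarrow> real"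
  where "hyperplane_vol n \<theta> A =
    (let u = (SOME u. orthonormal_basis_of_hyperplane n \<theta> u)
     in vol (n - 1) {c \<in> topspace (Euclidean_space (n - 1)). (\<lambda>i. \<Sum>j<n-1. c j * u j i) \<in> A})"

lemma proj_in_hyperplane:
  assumes "unit_vector n \<theta>" and "x \<in> topspace (Euclidean_space n)"
  shows "proj n \<theta> x \<in> hyperplane n \<theta>"
proof -
  have "dot n (proj n \<theta> x) \<theta> = dot n x \<theta> - dot n x \<theta> * dot n \<theta> \<theta>"
    by (simp add: dot_def proj_def left_diff_distrib sum_subtractf sum_distrib_left mult.assoc)
  with assms show ?thesis
    by (simp add: hyperplane_def unit_vector_def proj_def topspace_Euclidean_space)
qed

text \<open>
  The basis is obtained from the first \<^term>\<open>n - 1\<close> standard unit vectors by the reflection that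
  maps the last standard unit vector to \<^term>\<open>\<theta>\<close>.
\<close>

lemma ex_orthonormal_basis_of_hyperplane:
  assumes "n \<ge> 1" and \<theta>: "unit_vector n \<theta>"
  shows "\<exists>u. orthonormal_basis_of_hyperplane n \<theta> u"
proof -
  define m where "m = n - 1"
  have m: "m < n" and n: "n = Suc m" using assms by (auto simp: m_def)
  define e :: "nat \<Rightarrow> nat \<Rightarrow> real" where "e = (\<lambda>j i. if i = j then 1 else 0)"
  define w where "w = (\<lambda>i. e m i - \<theta> i)"
  define W where "W = dot n w w"
  define u where "u = (\<lambda>j i. e j i - 2 * w j / W * w i)"
  have \<theta>0: "\<theta> i = 0" if "i \<ge> n" for i
    using \<theta> that by (auto simp: unit_vector_def topspace_Euclidean_space)
  have \<theta>1: "dot n \<theta> \<theta> = 1"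
    using \<theta> by (auto simp: unit_vector_def)
  have dot_comm: "dot n x y = dot n y x" for x y
    by (simp add: dot_def mult.commute)
  have dot_diff: "dot n (\<lambda>i. x i - a * y i) z = dot n x z - a * dot n y z" for x y z a
    by (simp add: dot_def left_diff_distrib sum_subtractf sum_distrib_left mult.assoc)
  have dot_e: "dot n (e j) x = x j" if "j < n" for j x
    using that by (simp add: dot_def e_def if_distrib[of "\<lambda>a. a * _"] cong: if_cong)
  have w\<theta>: "dot n w \<theta> = \<theta> m - 1"
    using dot_diff[of "e m" 1 \<theta> \<theta>] by (simp add: w_def dot_e m \<theta>1)
  have W: "W = 2 - 2 * \<theta> m"
  proof -
    have "W = dot n (e m) w - dot n \<theta> w"
      using dot_diff[of "e m" 1 \<theta> w] by (simp add: W_def w_def)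
    then show ?thesis
      using w\<theta> by (simp add: dot_e m dot_comm[of \<theta> w]) (simp add: w_def e_def)
  qed
  have W0: "w i = 0" if "W = 0" "i < n" for i
    using that by (simp add: W_def dot_def sum_nonneg_eq_0_iff)
  have zero: "u j i = 0" if "j < m" "i \<ge> n" for i j
    using that m \<theta>0[of i] by (auto simp: u_def w_def e_def)
  have perp: "dot n (u j) \<theta> = 0" if j: "j < m" for j
  proof -
    have wj: "w j = - \<theta> j" using j by (simp add: w_def e_def)
    have "dot n (u j) \<theta> = \<theta> j - 2 * w j / W * (\<theta> m - 1)"
      unfolding u_def dot_diff w\<theta> using j m by (simp add: dot_e)
    also have "\<dots> = 0"
    proof (cases "W = 0")
      case True
      then show ?thesis using W0[of j] wj j m by simp
    next
      case False
      have "\<theta> m - 1 = - W / 2" using W by simp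
      then show ?thesis using wj False by simp
    qed
    finally show ?thesis .
  qed
  have orth: "dot n (u j) (u k) = e j k" if jk: "j < m" "k < m" for j k
  proof -
    have 1: "dot n x (u k) = x k - 2 * w k / W * dot n x w" for x
      using dot_diff[of "e k" "2 * w k / W" w x] jk m
      by (simp add: u_def dot_e dot_comm[of x])
    have 2: "dot n (u j) w = w j - 2 * w j / W * W"
      unfolding u_def dot_diff W_def[symmetric] using jk m by (simp add: dot_e)
    show ?thesis
      unfolding 1 2 using W0[of k] jk m by (cases "W = 0") (auto simp: u_def field_simps)
  qed
  show ?thesis
    unfolding orthonormal_basis_of_hyperplane_def m_def[symmetric]
    using zero perp orth
    by (intro exI[of _ u]) (auto simp: hyperplane_def topspace_Euclidean_space e_def)
qed

end

theory Submission
  imports Defs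
begin

text \<open>
  Compare a convex body \<open>K\<close> with its translate \<open>K + t\<theta>\<close>. A chord of \<open>K\<close> in direction \<open>\<theta>\<close> sticks
  out of its own translate by a piece of length at most \<open>t\<close>, and the chords are indexed by the shadow
  \<open>P\<^sub>\<theta> K\<close>, so \<open>|K| \<le> |K \<inter> (K + t\<theta>)| + t |P\<^sub>\<theta> K|\<close> (\<open>vol_le_overlap_plus_shadow\<close>). Shadows are
  therefore large in every direction once a short translation in any direction destroys half of the
  overlap; in terms of \<open>r = |K|\<^bsup>1/n\<^esup>\<close> the translation may have length of order \<open>r / \<surd>n\<close>.

  Such a body is found among the bodies \<open>K\<^sub>h = {x. |\<langle>u\<^sub>i, x\<rangle>| \<le> h\<^sub>i for all i < m}\<close> with fixed
  directions \<open>u\<^sub>i\<close> and \<open>m\<close> proportional to \<open>n\<close>. The overlap \<open>K\<^sub>h \<inter> (K\<^sub>h + t\<theta>)\<close> lies in a translate of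
  \<open>K\<^sub>g\<close>, where \<open>g\<^sub>i = h\<^sub>i - t |\<langle>u\<^sub>i, \<theta>\<rangle>| / 2\<close> (\<open>vol_overlap_slab_body_le\<close>). Let \<open>h\<close> maximise \<open>|K\<^sub>h|\<close>, up
  to a constant factor, subject to \<open>\<Sum> h\<^sub>i \<le> m\<close>. Since \<open>|K\<^sub>h|\<close> is homogeneous of degree \<open>n\<close> in \<open>h\<close>,
  maximality bounds \<open>|K\<^sub>g|\<close> by a constant times \<open>(\<Sum> g\<^sub>i / m)\<^sup>n |K\<^sub>h|\<close>. If \<open>\<Sum> |\<langle>u\<^sub>i, \<theta>\<rangle>| \<ge> c m\<close> for every
  unit vector \<open>\<theta>\<close>, then \<open>t = 6 / (c n)\<close> makes this at most \<open>|K\<^sub>h| / 2\<close>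
  (\<open>near_maximal_slab_body_shadow\<close>). An exact maximiser would have facets of equal area, as in
  Minkowski's existence theorem; comparing volumes inside the family avoids both that theorem and
  Cauchy's formula for the area of a shadow.

  Two estimates remain. The volume of \<open>K\<^sub>h\<close> must not be too small, and by maximality it is enough to
  bound \<open>|K\<^sub>1|\<close> for \<open>h = 1\<close>: cut the cube of half-side \<open>1/\<surd>n\<close> into cells according to the integer parts of
  the numbers \<open>\<langle>u\<^sub>i, x\<rangle>\<close>. Each cell lies in a translate of \<open>K\<^sub>1\<close>, and there are only exponentially many
  cells if \<open>\<Sum> |\<langle>u\<^sub>i, x\<rangle>| \<le> B m |x|\<close> (\<open>vol_unit_slab_body_ge\<close>). So everything reduces to
  directions with
  \<open>c m |x| \<le> \<Sum> |\<langle>u\<^sub>i, x\<rangle>| \<le> B m |x|\<close> for all \<open>x\<close>, where \<open>c\<close>, \<open>B\<close> and \<open>m/n\<close> do not depend on \<open>n\<close>.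
  Random sign vectors have this property (\<open>exists_spread_slab_system\<close>): exponential moments show that
  each of the two inequalities fails at a given \<open>x\<close> for an exponentially small proportion of the sign
  systems, and a lattice net of exponential size passes from fixed \<open>x\<close> to all \<open>x\<close>.
\<close>

section \<open>Inner products and Euclidean norms\<close>

lemma dot_add_right: "dot n u (\<lambda>j. x j + y j) = dot n u x + dot n u y"
  by (simp add: dot_def distrib_left sum.distrib)

lemma dot_scale_right: "dot n u (\<lambda>j. a * x j) = a * dot n u x"
  by (simp add: dot_def sum_distrib_left algebra_simps)

lemma dot_commute: "dot n x y = dot n y x"
  by (simp add: dot_def mult.commute)

lemma abs_dot_le: "\<bar>dot n x y\<bar> \<le> L2_set x {..<n} * L2_set y {..<n}"
  unfolding dot_def by (rule order_trans[OF sum_abs]) (simp add: abs_mult L2_set_mult_ineq)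

lemma coordinate_le_L2_set:
  fixes z :: "nat \<Rightarrow> real"
  shows "j < n \<Longrightarrow> \<bar>z j\<bar> \<le> L2_set z {..<n}"
  using member_le_L2_set[OF finite_lessThan, of j n "\<lambda>i. \<bar>z i\<bar>"] by (simp add: L2_set_def)

lemma L2_set_square: "(L2_set z {..<n})\<^sup>2 = (\<Sum>j<n. (z j)\<^sup>2)"
  by (simp add: L2_set_def sum_nonneg)

lemma sum_abs_le_L2_set: "(\<Sum>j<n. \<bar>x j\<bar>) \<le> sqrt (real n) * L2_set x {..<n}"
  using L2_set_mult_ineq[of x "\<lambda>_. 1" "{..<n}"] by (simp add: L2_set_constant mult.commute)

lemma L2_set_mono_abs:
  assumes "\<And>j. j < n \<Longrightarrow> \<bar>x j\<bar> \<le> \<bar>y j\<bar>"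
  shows "L2_set x {..<n} \<le> L2_set y {..<n}"
  unfolding L2_set_def using assms by (intro real_sqrt_le_mono sum_mono) (simp add: abs_le_square_iff)

lemma L2_set_scale: "L2_set (\<lambda>j. a * x j) {..<n} = \<bar>a\<bar> * L2_set x {..<n}"
  by (simp add: L2_set_def power_mult_distrib real_sqrt_mult flip: sum_distrib_left)

section \<open>Exponential moments of random sign sums\<close>

definition sign_vectors :: "nat \<Rightarrow> (nat \<Rightarrow> real) set"
  where "sign_vectors n = PiE {..<n} (\<lambda>_. {-1, 1})"

lemma finite_sign_vectors: "finite (sign_vectors n)"
  by (simp add: sign_vectors_def finite_PiE)

lemma card_sign_vectors: "card (sign_vectors n) = 2 ^ n"
  by (simp add: sign_vectors_def card_PiE card_insert_if numeral_2_eq_2)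

lemma sum_sign_vectors_prod:
  fixes f :: "nat \<Rightarrow> real \<Rightarrow> 'a :: comm_semiring_1"
  shows "(\<Sum>e\<in>sign_vectors n. \<Prod>j<n. f j (e j)) = (\<Prod>j<n. f j (-1) + f j 1)"
  unfolding sign_vectors_def by (subst prod_sum_PiE [symmetric]) auto

text \<open>
  The sharper bound by \<open>2 * exp (x\<^sup>2 / 2)\<close> holds for all \<open>x\<close>, but on \<open>[-1, 1]\<close> quadratic Taylor bounds
  suffice, and only coordinates of vectors in the unit ball are inserted below.
\<close>

lemma exp_plus_exp_minus_le:
  fixes x :: real
  assumes "\<bar>x\<bar> \<le> 1"
  shows "exp x + exp (- x) \<le> 2 * exp (x\<^sup>2)"
proof -
  have *: "exp y + exp (- y) \<le> 2 * exp (y\<^sup>2)" if y: "0 \<le> y" "y \<le> 1" for y :: real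
  proof -
    have pos: "1 + y + y\<^sup>2 / 2 > 0" using y by (simp add: add_pos_nonneg)
    have "exp (- y) \<le> 1 / (1 + y + y\<^sup>2 / 2)"
      using exp_lower_Taylor_quadratic[OF y(1)] pos
      by (simp add: exp_minus divide_simps)
    also have "\<dots> \<le> 1 - y + y\<^sup>2"
    proof -
      have "(1 - y + y\<^sup>2) * (1 + y + y\<^sup>2 / 2) = 1 + y\<^sup>2 / 2 + y ^ 3 / 2 + y ^ 4 / 2"
        by (simp add: power2_eq_square power3_eq_cube power4_eq_xxxx field_simps)
      then have "1 \<le> (1 - y + y\<^sup>2) * (1 + y + y\<^sup>2 / 2)" using y by simp
      then show ?thesis using pos by (simp add: pos_divide_le_eq)
    qed
    finally have "exp y + exp (- y) \<le> 2 * (1 + y\<^sup>2)"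
      using exp_bound[OF y] by simp
    also have "\<dots> \<le> 2 * exp (y\<^sup>2)"
      by (intro mult_left_mono exp_ge_add_one_self) auto
    finally show ?thesis .
  qed
  show ?thesis
    using *[of x] *[of "- x"] assms by (cases "x \<ge> 0") auto
qed

lemma cos_le_exp_minus_square:
  fixes x :: real
  assumes "\<bar>x\<bar> \<le> 1"
  shows "cos x \<le> exp (- x\<^sup>2 / 3)"
proof -
  obtain t where t: "cos x = (\<Sum>m<3. cos_coeff m * x ^ m) + cos (t + 1/2 * real 3 * pi) / fact 3 * x ^ 3"
    using Maclaurin_cos_expansion[of x 3] by blast
  have s: "(\<Sum>m<3. cos_coeff m * x ^ m) = 1 - x\<^sup>2 / 2"
    by (simp add: numeral_3_eq_3 cos_coeff_def power2_eq_square)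
  have "cos (t + 1/2 * real 3 * pi) / fact 3 * x ^ 3 \<le> \<bar>cos (t + 1/2 * real 3 * pi)\<bar> * \<bar>x ^ 3\<bar> / 6"
    by (simp add: fact_numeral flip: abs_mult)
  also have "\<dots> \<le> 1 * \<bar>x ^ 3\<bar> / 6"
    by (intro divide_right_mono mult_right_mono) auto
  also have "\<bar>x ^ 3\<bar> \<le> x\<^sup>2"
    using mult_right_mono[OF assms, of "x\<^sup>2"]
    by (simp add: power3_eq_cube power2_eq_square abs_mult)
  finally have "cos x \<le> 1 + (- x\<^sup>2 / 3)" unfolding t s by (simp add: fact_numeral)
  also have "\<dots> \<le> exp (- x\<^sup>2 / 3)" by (rule exp_ge_add_one_self)
  finally show ?thesis .
qed

text \<open>
  Cosines are easier to average over signs than \<open>exp (- \<bar>x\<bar>)\<close>, because the average of \<open>cos\<close> of a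
  sign sum factorises. This inequality trades one for the other, at the price of the factor 3: the
  left-hand side times 3 is at most \<open>min \<bar>x\<bar> 2\<close>, which is at most \<open>3 * \<bar>x\<bar> / (1 + \<bar>x\<bar>)\<close>.
\<close>

lemma one_minus_cos_le:
  fixes x :: real
  shows "(1 - cos x) / 3 \<le> 1 - exp (- \<bar>x\<bar>)"
proof -
  have a: "1 - cos x \<le> \<bar>x\<bar>"
    using abs_sin_x_le_abs_x[of "x/2"] abs_sin_le_one[of "x/2"] cos_double_sin[of "x/2"]
      mult_mono[of "\<bar>sin (x/2)\<bar>" "\<bar>x/2\<bar>" "\<bar>sin (x/2)\<bar>" 1]
    by (simp add: power2_eq_square abs_mult_self_eq)
  have b: "1 - cos x \<le> 2" using cos_ge_minus_one[of x] by linarith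
  have "(1 - cos x) * (1 + \<bar>x\<bar>) \<le> 3 * \<bar>x\<bar>"
  proof (cases "\<bar>x\<bar> \<le> 2")
    case True
    have "(1 - cos x) * (1 + \<bar>x\<bar>) \<le> \<bar>x\<bar> * 3" using a True by (intro mult_mono) auto
    then show ?thesis by simp
  next
    case False
    have "(1 - cos x) * (1 + \<bar>x\<bar>) \<le> 2 * (1 + \<bar>x\<bar>)" using b by (intro mult_right_mono) auto
    then show ?thesis using False by simp
  qed
  then have "(1 - cos x) / 3 \<le> 1 - 1 / (1 + \<bar>x\<bar>)" by (simp add: field_simps)
  also have "\<dots> \<le> 1 - exp (- \<bar>x\<bar>)"
    using le_imp_inverse_le[OF exp_ge_add_one_self[of "\<bar>x\<bar>"]]
    by (simp add: exp_minus divide_inverse)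
  finally show ?thesis .
qed

lemma sum_exp_dot_sign_vectors:
  "(\<Sum>e\<in>sign_vectors n. exp (dot n e z)) = (\<Prod>j<n. exp (- z j) + exp (z j))"
proof -
  have "(\<Sum>e\<in>sign_vectors n. exp (dot n e z)) = (\<Sum>e\<in>sign_vectors n. \<Prod>j<n. exp (e j * z j))"
    by (simp add: dot_def exp_sum)
  also have "\<dots> = (\<Prod>j<n. exp (- z j) + exp (z j))"
    using sum_sign_vectors_prod[of "\<lambda>j s. exp (s * z j)" n] by simp
  finally show ?thesis .
qed

text \<open>
  Real part of the factorisation of the characteristic function of a sum of independent signs.
\<close>

lemma sum_cos_dot_sign_vectors:
  "(\<Sum>e\<in>sign_vectors n. cos (dot n e z)) = 2 ^ n * (\<Prod>j<n. cos (z j))"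
proof -
  have "(\<Sum>e\<in>sign_vectors n. cis (dot n e z)) = (\<Sum>e\<in>sign_vectors n. \<Prod>j<n. cis (e j * z j))"
    by (simp add: dot_def cis_conv_exp exp_sum sum_distrib_left)
  also have "\<dots> = (\<Prod>j<n. cis (- z j) + cis (z j))"
    using sum_sign_vectors_prod[of "\<lambda>j s. cis (s * z j)" n] by simp
  also have "\<dots> = (\<Prod>j<n. complex_of_real (2 * cos (z j)))"
    by (intro prod.cong) (auto simp: complex_eq_iff)
  also have "\<dots> = complex_of_real (2 ^ n * (\<Prod>j<n. cos (z j)))"
    by (simp only: of_real_prod[symmetric] prod.distrib) simp
  finally have "Re (\<Sum>e\<in>sign_vectors n. cis (dot n e z)) = 2 ^ n * (\<Prod>j<n. cos (z j))"
    by (simp only: Re_complex_of_real)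
  then show ?thesis by simp
qed

lemma sum_exp_abs_dot_sign_vectors_le:
  assumes "L2_set z {..<n} \<le> 1"
  shows "(\<Sum>e\<in>sign_vectors n. exp \<bar>dot n e z\<bar>) \<le> 2 ^ n * (2 * exp 1)"
proof -
  have z: "\<bar>z j\<bar> \<le> 1" if "j < n" for j
    using coordinate_le_L2_set[OF that, of z] assms by linarith
  have *: "(\<Prod>j<n. exp (- z j) + exp (z j)) \<le> 2 ^ n * exp 1"
  proof -
    have "(\<Prod>j<n. exp (- z j) + exp (z j)) \<le> (\<Prod>j<n. 2 * exp ((z j)\<^sup>2))"
      using exp_plus_exp_minus_le[OF z] by (intro prod_mono) (auto simp: add.commute add_nonneg_nonneg)
    also have "\<dots> = 2 ^ n * exp ((L2_set z {..<n})\<^sup>2)"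
      by (simp add: prod.distrib L2_set_square exp_sum)
    also have "\<dots> \<le> 2 ^ n * exp 1"
      using assms by (simp add: abs_square_le_1)
    finally show ?thesis .
  qed
  have "(\<Sum>e\<in>sign_vectors n. exp \<bar>dot n e z\<bar>)
      \<le> (\<Sum>e\<in>sign_vectors n. exp (dot n e z) + exp (dot n e (\<lambda>j. - z j)))"
    by (intro sum_mono) (auto simp: dot_def abs_if sum_negf)
  also have "\<dots> = 2 * (\<Prod>j<n. exp (- z j) + exp (z j))"
    by (simp add: sum.distrib sum_exp_dot_sign_vectors add.commute)
  also have "\<dots> \<le> 2 * (2 ^ n * exp 1)" using * by simp
  finally show ?thesis by simp
qed

text \<open>
  A bound, below 1, for the mean of \<open>exp (- \<bar>X\<bar>)\<close> over sign sums \<open>X\<close> whose coefficient vector has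
  norm between \<open>1/2\<close> and \<open>1\<close>. For such vectors the product of the cosines of the coordinates is at most
  \<open>exp (- (1/2)\<^sup>2 / 3) = exp (-1/12)\<close>.
\<close>

definition thinning_rate :: real
  where "thinning_rate = 1 - (1 - exp (-1/12)) / 3"

lemma thinning_rate: "0 < thinning_rate" "thinning_rate < 1"
proof -
  have "0 < 1 - (1 - e) / 3" "1 - (1 - e) / 3 < 1" if "0 < e" "e < 1" for e :: real
    using that by auto
  from this[of "exp (-1/12)"] show "0 < thinning_rate" "thinning_rate < 1"
    unfolding thinning_rate_def by simp_all
qed

lemma sum_exp_minus_abs_dot_sign_vectors_le:
  assumes "1/2 \<le> L2_set z {..<n}" "L2_set z {..<n} \<le> 1"
  shows "(\<Sum>e\<in>sign_vectors n. exp (- \<bar>dot n e z\<bar>)) \<le> 2 ^ n * thinning_rate"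
proof -
  have z: "\<bar>z j\<bar> \<le> 1" if "j < n" for j
    using coordinate_le_L2_set[OF that, of z] assms by linarith
  have cos0: "0 \<le> cos (z j)" if "j < n" for j
    using z[OF that] pi_half_gt_zero pi_gt3 by (intro cos_ge_zero) auto
  have "(\<Prod>j<n. cos (z j)) \<le> (\<Prod>j<n. exp (- (z j)\<^sup>2 / 3))"
    using z cos0 cos_le_exp_minus_square by (intro prod_mono) auto
  also have "\<dots> = exp (- (L2_set z {..<n})\<^sup>2 / 3)"
    by (simp add: L2_set_square exp_sum sum_divide_distrib flip: sum_negf)
  also have "\<dots> \<le> exp (-1/12)"
    using power_mono[OF assms(1), of 2] by (simp add: power2_eq_square)
  finally have P: "(\<Prod>j<n. cos (z j)) \<le> exp (-1/12)" .
  have "(\<Sum>e\<in>sign_vectors n. exp (- \<bar>dot n e z\<bar>))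
      \<le> (\<Sum>e\<in>sign_vectors n. 1 - (1 - cos (dot n e z)) / 3)"
    by (intro sum_mono) (use one_minus_cos_le in \<open>auto simp: algebra_simps\<close>)
  also have "\<dots> = 2 ^ n * (1 - (1 - (\<Prod>j<n. cos (z j))) / 3)"
    by (simp add: sum_subtractf sum_cos_dot_sign_vectors card_sign_vectors flip: sum_divide_distrib)
       (simp add: algebra_simps)
  also have "\<dots> \<le> 2 ^ n * thinning_rate"
    unfolding thinning_rate_def using P by (intro mult_left_mono) auto
  finally show ?thesis .
qed

section \<open>Lattice nets and counting\<close>

text \<open>
  The functions are restricted to the index set \<open>{..<n}\<close>, so that this set is finite.
\<close>

definition int_vectors :: "nat \<Rightarrow> nat \<Rightarrow> (nat \<Rightarrow> int) set"
  where "int_vectors n L = {z \<in> PiE {..<n} (\<lambda>_. UNIV). (\<Sum>j<n. \<bar>z j\<bar>) \<le> int L}"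

lemma sum_half_power_abs:
  "(\<Sum>k\<in>{- int L..int L}. (1/2 :: real) ^ nat \<bar>k\<bar>) = 3 - 2 * (1/2) ^ L"
proof (induction L)
  case 0
  then show ?case by simp
next
  case (Suc L)
  have "{- int (Suc L)..int (Suc L)}
      = insert (- int (Suc L)) (insert (int (Suc L)) {- int L..int L})"
    by auto
  then show ?case using Suc by (simp add: nat_add_distrib)
qed

text \<open>
  Every vector counted has weight at least 1 when it is weighted by \<open>2 ^ L\<close> times the product of the
  numbers \<open>2 ^ (- \<bar>z j\<bar>)\<close>, and the total weight factorises into sums over one coordinate, each at
  most 3.
\<close>

lemma int_vectors_bound:
  "finite (int_vectors n L)" "real (card (int_vectors n L)) \<le> 3 ^ n * 2 ^ L"
proof -
  let ?P = "PiE {..<n} (\<lambda>_. {- int L..int L})"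
  have finP: "finite ?P" by (simp add: finite_PiE)
  have "z j \<in> {- int L..int L}" if "z \<in> int_vectors n L" "j < n" for z j
  proof -
    have "\<bar>z j\<bar> \<le> (\<Sum>j<n. \<bar>z j\<bar>)"
      using member_le_sum[of j "{..<n}" "\<lambda>j. \<bar>z j\<bar>"] that(2) by simp
    also have "\<dots> \<le> int L" using that(1) by (simp add: int_vectors_def)
    finally show ?thesis by (simp add: abs_le_iff)
  qed
  then have sub: "int_vectors n L \<subseteq> ?P"
    by (auto simp: int_vectors_def PiE_def Pi_def)
  then show fin: "finite (int_vectors n L)" using finP by (rule finite_subset)
  have "real (card (int_vectors n L))
      \<le> (\<Sum>z\<in>int_vectors n L. 2 ^ L * (\<Prod>j<n. (1/2) ^ nat \<bar>z j\<bar>))"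
  proof -
    have "1 \<le> 2 ^ L * (\<Prod>j<n. (1/2 :: real) ^ nat \<bar>z j\<bar>)" if "z \<in> int_vectors n L" for z
    proof -
      have "int (\<Sum>j<n. nat \<bar>z j\<bar>) \<le> int L"
        using that by (simp add: int_vectors_def)
      then have "(\<Sum>j<n. nat \<bar>z j\<bar>) \<le> L" by (simp only: of_nat_le_iff)
      then have "(1/2 :: real) ^ L \<le> (1/2) ^ (\<Sum>j<n. nat \<bar>z j\<bar>)"
        by (intro power_decreasing) auto
      then have "2 ^ L * (1/2 :: real) ^ L \<le> 2 ^ L * (\<Prod>j<n. (1/2) ^ nat \<bar>z j\<bar>)"
        by (simp add: power_sum)
      then show ?thesis by (simp add: power_one_over)
    qed
    then have "(\<Sum>z\<in>int_vectors n L. 1 :: real) \<le> (\<Sum>z\<in>int_vectors n L. 2 ^ L * (\<Prod>j<n. (1/2) ^ nat \<bar>z j\<bar>))"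
      by (rule sum_mono)
    then show ?thesis by simp
  qed
  also have "\<dots> \<le> (\<Sum>z\<in>?P. 2 ^ L * (\<Prod>j<n. (1/2) ^ nat \<bar>z j\<bar>))"
    using sub finP by (intro sum_mono2 mult_nonneg_nonneg prod_nonneg) auto
  also have "\<dots> = 2 ^ L * (\<Prod>j<n. \<Sum>k\<in>{- int L..int L}. (1/2) ^ nat \<bar>k\<bar>)"
    by (subst prod_sum_PiE) (auto simp: sum_distrib_left)
  also have "\<dots> = 2 ^ L * (3 - 2 * (1/2) ^ L) ^ n"
    by (simp add: sum_half_power_abs)
  also have "\<dots> \<le> 2 ^ L * 3 ^ n"
    using power_le_one[of "1/2 :: real" L] by (intro mult_left_mono power_mono) auto
  finally show "real (card (int_vectors n L)) \<le> 3 ^ n * 2 ^ L" by (simp add: mult.commute)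
qed

text \<open>
  Points of the lattice with mesh \<open>1 / (r \<surd>n)\<close>. The cell of this mesh has diameter \<open>1 / r\<close>, whatever
  the dimension.
\<close>

definition lattice_point :: "nat \<Rightarrow> nat \<Rightarrow> (nat \<Rightarrow> int) \<Rightarrow> nat \<Rightarrow> real"
  where "lattice_point n r z = (\<lambda>j. of_int (z j) / (real r * sqrt (real n)))"

text \<open>
  Rounding every coordinate towards zero keeps the point inside the ball, and it keeps the coordinate
  sum of the integer vector at most \<open>r * n\<close> because the l1 norm is at most \<open>\<surd>n\<close> times the Euclidean
  norm. So the net has at most \<open>(3 * 2 ^ r) ^ n\<close> points.
\<close>

lemma exists_lattice_point:
  assumes n: "n \<ge> 1" and r: "r \<ge> 1" and x: "L2_set x {..<n} \<le> 1"
  obtains z where "z \<in> int_vectors n (r * n)"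
    "L2_set (lattice_point n r z) {..<n} \<le> L2_set x {..<n}"
    "L2_set (\<lambda>j. x j - lattice_point n r z j) {..<n} \<le> 1 / real r"
proof -
  define s where "s = real r * sqrt (real n)"
  have s: "s > 0" using n r by (simp add: s_def)
  have "\<exists>k::int. \<bar>real_of_int k\<bar> \<le> \<bar>t\<bar> \<and> \<bar>t - real_of_int k\<bar> \<le> 1" for t :: real
  proof (cases "t \<ge> 0")
    case True
    then have "0 \<le> real_of_int \<lfloor>t\<rfloor>" by simp
    then show ?thesis using True by (intro exI[of _ "\<lfloor>t\<rfloor>"] conjI) linarith+
  next
    case False
    then have "real_of_int \<lceil>t\<rceil> \<le> 0" by (simp add: ceiling_le_iff)
    then show ?thesis using False by (intro exI[of _ "\<lceil>t\<rceil>"] conjI) linarith+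
  qed
  then obtain k where k: "\<bar>real_of_int (k t)\<bar> \<le> \<bar>t\<bar>" "\<bar>t - real_of_int (k t)\<bar> \<le> 1" for t
    by metis
  define z where "z = (\<lambda>j\<in>{..<n}. k (s * x j))"
  have z: "\<bar>real_of_int (z j)\<bar> \<le> s * \<bar>x j\<bar>" "\<bar>s * x j - z j\<bar> \<le> 1" if "j < n" for j
    using k[of "s * x j"] that s by (simp_all add: z_def abs_mult)
  have lp: "lattice_point n r z j = z j / s" for j by (simp add: lattice_point_def s_def)
  have "real_of_int (\<Sum>j<n. \<bar>z j\<bar>) \<le> (\<Sum>j<n. s * \<bar>x j\<bar>)"
    using z(1) by (auto intro!: sum_mono)
  also have "\<dots> \<le> s * (sqrt (real n) * 1)"
    unfolding sum_distrib_left[symmetric]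
    using sum_abs_le_L2_set[of x n] x s
    by (intro mult_left_mono order_trans[OF sum_abs_le_L2_set]) auto
  also have "\<dots> = real_of_int (int (r * n))" by (simp add: s_def)
  finally have "(\<Sum>j<n. \<bar>z j\<bar>) \<le> int (r * n)" by (simp only: of_int_le_iff)
  then have "z \<in> int_vectors n (r * n)"
    by (simp add: int_vectors_def z_def)
  moreover have "L2_set (lattice_point n r z) {..<n} \<le> L2_set x {..<n}"
    using z(1) s by (intro L2_set_mono_abs) (simp add: lp field_simps)
  moreover have "L2_set (\<lambda>j. x j - lattice_point n r z j) {..<n} \<le> 1 / real r"
  proof -
    have "\<bar>x j - z j / s\<bar> \<le> \<bar>1 / s\<bar>" if "j < n" for j
    proof -
      have "x j - z j / s = (s * x j - z j) / s" using s by (simp add: field_simps)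
      then show ?thesis using z(2)[OF that] s by (simp add: divide_right_mono)
    qed
    then have "L2_set (\<lambda>j. x j - lattice_point n r z j) {..<n} \<le> L2_set (\<lambda>_. 1 / s) {..<n}"
      by (intro L2_set_mono_abs) (simp add: lp)
    also have "\<dots> = 1 / real r" using n s by (simp add: L2_set_constant s_def)
    finally show ?thesis .
  qed
  ultimately show ?thesis using that by blast
qed

text \<open>
  Chernoff's bound, with probabilities replaced by numbers of choices.
\<close>

lemma card_large_sum_le:
  fixes g :: "'a \<Rightarrow> real"
  assumes fin: "finite E"
  shows "real (card {e \<in> PiE {..<m} (\<lambda>_. E). a \<le> (\<Sum>i<m. g (e i))}) \<le> exp (- a) * (\<Sum>x\<in>E. exp (g x)) ^ m"
    (is "real (card ?S) \<le> _")
proof -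
  have finP: "finite (PiE {..<m} (\<lambda>_. E))" using fin by (simp add: finite_PiE)
  have "real (card ?S) * exp a \<le> (\<Sum>e\<in>?S. exp (\<Sum>i<m. g (e i)))"
    by (rule sum_bounded_below) auto
  also have "\<dots> \<le> (\<Sum>e\<in>PiE {..<m} (\<lambda>_. E). exp (\<Sum>i<m. g (e i)))"
    using finP by (intro sum_mono2) auto
  also have "\<dots> = (\<Sum>e\<in>PiE {..<m} (\<lambda>_. E). \<Prod>i<m. exp (g (e i)))"
    by (simp add: exp_sum)
  also have "\<dots> = (\<Sum>x\<in>E. exp (g x)) ^ m"
    using fin by (subst prod_sum_PiE[symmetric]) auto
  finally show ?thesis by (simp add: exp_minus field_simps)
qed

text \<open>
  The total by which the half-widths of the slabs \<open>\<bar>dot n (u i) y\<bar> \<le> h i\<close> shrink when a body is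
  replaced by its overlap with the translate by \<open>2 * x\<close>. For fixed \<open>u\<close> it is a seminorm in \<open>x\<close>.
\<close>

definition slab_sum :: "nat \<Rightarrow> nat \<Rightarrow> (nat \<Rightarrow> nat \<Rightarrow> real) \<Rightarrow> (nat \<Rightarrow> real) \<Rightarrow> real"
  where "slab_sum n m u x = (\<Sum>i<m. \<bar>dot n (u i) x\<bar>)"

lemma slab_sum_triangle:
  "slab_sum n m u x \<le> slab_sum n m u y + slab_sum n m u (\<lambda>j. x j - y j)"
proof -
  have "dot n (u i) x = dot n (u i) y + dot n (u i) (\<lambda>j. x j - y j)" for i
    by (simp add: dot_add_right[symmetric])
  then show ?thesis
    unfolding slab_sum_def sum.distrib[symmetric] by (intro sum_mono) (simp add: abs_triangle_ineq)
qed

lemma slab_sum_scale: "slab_sum n m u (\<lambda>j. a * x j) = \<bar>a\<bar> * slab_sum n m u x"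
  by (simp add: slab_sum_def dot_scale_right abs_mult sum_distrib_left)

text \<open>
  The supremum \<open>S\<close> over the unit ball satisfies \<open>S \<le> b + S / 2\<close>, since a point of the ball differs from
  a net point by a vector of norm at most \<open>1/2\<close>.
\<close>

lemma slab_sum_le_of_net:
  assumes n: "n \<ge> 1"
    and net: "\<And>z. z \<in> int_vectors n (2 * n) \<Longrightarrow> L2_set (lattice_point n 2 z) {..<n} \<le> 1 \<Longrightarrow>
      slab_sum n m u (lattice_point n 2 z) \<le> b"
    and x: "L2_set x {..<n} \<le> 1"
  shows "slab_sum n m u x \<le> 2 * b"
proof -
  let ?D = "{x. L2_set x {..<n} \<le> 1}"
  define S where "S = (SUP x\<in>?D. slab_sum n m u x)"
  have "slab_sum n m u y \<le> (\<Sum>i<m. L2_set (u i) {..<n})" if "y \<in> ?D" for y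
    unfolding slab_sum_def using that
    by (intro sum_mono order_trans[OF abs_dot_le]) (simp add: mult_left_le)
  then have "bdd_above (slab_sum n m u ` ?D)" by (auto intro!: bdd_aboveI2)
  then have S: "slab_sum n m u y \<le> S" if "y \<in> ?D" for y
    unfolding S_def using that by (intro cSUP_upper)
  have "slab_sum n m u y \<le> b + S / 2" if "y \<in> ?D" for y
  proof -
    have y: "L2_set y {..<n} \<le> 1" using that by simp
    obtain z where z: "z \<in> int_vectors n (2 * n)"
      "L2_set (lattice_point n 2 z) {..<n} \<le> L2_set y {..<n}"
      "L2_set (\<lambda>j. y j - lattice_point n 2 z j) {..<n} \<le> 1 / real 2"
      by (rule exists_lattice_point[OF n one_le_numeral y])
    have "slab_sum n m u (\<lambda>j. 2 * (y j - lattice_point n 2 z j)) \<le> S"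
      using z(3) L2_set_scale[of 2 "\<lambda>j. y j - lattice_point n 2 z j" n] by (intro S CollectI) linarith
    then have "slab_sum n m u (\<lambda>j. y j - lattice_point n 2 z j) \<le> S / 2"
      by (simp only: slab_sum_scale)
    moreover have "slab_sum n m u (lattice_point n 2 z) \<le> b" using z that by (intro net) auto
    ultimately show ?thesis using slab_sum_triangle[of n m u y "lattice_point n 2 z"] by linarith
  qed
  then have "S \<le> b + S / 2"
    unfolding S_def[of] by (intro cSUP_least) (auto intro!: exI[of _ "\<lambda>_. 0"] simp: L2_set_def)
  then show ?thesis using S[of x] x by simp
qed

section \<open>Sign vectors with a two-sided l1 bound\<close>

definition sign_systems :: "nat \<Rightarrow> nat \<Rightarrow> (nat \<Rightarrow> nat \<Rightarrow> real) set"
  where "sign_systems n m = PiE {..<m} (\<lambda>_. sign_vectors n)"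

lemma card_sign_systems: "card (sign_systems n m) = (2 ^ n) ^ m"
  by (simp add: sign_systems_def card_PiE card_sign_vectors)

lemma card_slab_sum_large_le:
  assumes "L2_set z {..<n} \<le> 1"
  shows "real (card {u \<in> sign_systems n m. b * real m \<le> slab_sum n m u z})
    \<le> card (sign_systems n m) * (2 * exp (1 - b)) ^ m"
proof -
  have "real (card {u \<in> sign_systems n m. b * real m \<le> slab_sum n m u z})
      \<le> exp (- (b * real m)) * (\<Sum>e\<in>sign_vectors n. exp \<bar>dot n e z\<bar>) ^ m"
    unfolding sign_systems_def slab_sum_def
    by (rule card_large_sum_le) (rule finite_sign_vectors)
  also have "\<dots> \<le> exp (- (b * real m)) * (2 ^ n * (2 * exp 1)) ^ m"
    using sum_exp_abs_dot_sign_vectors_le[OF assms]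
    by (intro mult_left_mono power_mono sum_nonneg) auto
  also have "exp (- (b * real m)) = exp (- b) ^ m"
    by (simp add: exp_of_nat_mult[symmetric] mult.commute)
  also have "exp (- b) ^ m * (2 ^ n * (2 * exp 1)) ^ m = (2 ^ n) ^ m * (2 * exp (1 - b)) ^ m"
    using exp_add[of 1 "- b"] by (simp only: diff_conv_add_uminus power_mult_distrib mult_ac)
  finally show ?thesis by (simp add: card_sign_systems)
qed

text \<open>
  Lower deviations are Chernoff's bound for the negative absolute values: the exponential moment is
  below 1, so a small constant \<open>c\<close> still leaves exponential decay in \<open>m\<close>.
\<close>

lemma card_slab_sum_small_le:
  assumes "1/2 \<le> L2_set z {..<n}" "L2_set z {..<n} \<le> 1"
  shows "real (card {u \<in> sign_systems n m. slab_sum n m u z \<le> c * real m})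
    \<le> card (sign_systems n m) * (exp c * thinning_rate) ^ m"
proof -
  have "{u \<in> sign_systems n m. slab_sum n m u z \<le> c * real m}
      = {u \<in> PiE {..<m} (\<lambda>_. sign_vectors n). - (c * real m) \<le> (\<Sum>i<m. - \<bar>dot n (u i) z\<bar>)}"
    by (auto simp: sign_systems_def slab_sum_def sum_negf)
  then have "real (card {u \<in> sign_systems n m. slab_sum n m u z \<le> c * real m})
      \<le> exp (- (- (c * real m))) * (\<Sum>e\<in>sign_vectors n. exp (- \<bar>dot n e z\<bar>)) ^ m"
    using card_large_sum_le[OF finite_sign_vectors, of m n "- (c * real m)" "\<lambda>e. - \<bar>dot n e z\<bar>"]
    by simp
  also have "\<dots> \<le> exp (- (- (c * real m))) * (2 ^ n * thinning_rate) ^ m"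
    using sum_exp_minus_abs_dot_sign_vectors_le[OF assms]
    by (intro mult_left_mono power_mono sum_nonneg) auto
  also have "exp (- (- (c * real m))) = exp c ^ m"
    by (simp add: exp_of_nat_mult[symmetric] mult.commute)
  also have "exp c ^ m * (2 ^ n * thinning_rate) ^ m
      = (2 ^ n) ^ m * (exp c * thinning_rate) ^ m"
    by (simp only: power_mult_distrib mult.assoc mult.left_commute)
  finally show ?thesis by (simp add: card_sign_systems)
qed

lemma card_net_UN_le:
  fixes B :: "(nat \<Rightarrow> int) \<Rightarrow> 'a set"
  assumes "N \<subseteq> int_vectors n L" "\<And>z. z \<in> N \<Longrightarrow> real (card (B z)) \<le> w" "w \<ge> 0"
  shows "real (card (\<Union>z\<in>N. B z)) \<le> 3 ^ n * 2 ^ L * w"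
proof -
  have fin: "finite N" using assms(1) int_vectors_bound(1) by (rule finite_subset)
  have "real (card (\<Union>z\<in>N. B z)) \<le> real (\<Sum>z\<in>N. card (B z))"
    using card_UN_le[OF fin, of B] by (simp only: of_nat_le_iff)
  also have "\<dots> \<le> real (card N) * w"
    using sum_bounded_above[of N "\<lambda>z. real (card (B z))" w] assms(2) by simp
  also have "\<dots> \<le> (3 ^ n * 2 ^ L) * w"
    using card_mono[OF int_vectors_bound(1) assms(1)] int_vectors_bound(2)[of n L] assms(3)
    by (intro mult_right_mono) linarith+
  finally show ?thesis by simp
qed

text \<open>
  A unit vector is within \<open>1 / r\<close> of a net point of norm at least \<open>1/2\<close>. The upper bound controls the
  change of the sum between the two.
\<close>

lemma slab_sum_ge_of_net:
  assumes n: "n \<ge> 1" and r: "r \<ge> 2"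
    and net: "\<And>z. z \<in> int_vectors n (r * n) \<Longrightarrow> 1/2 \<le> L2_set (lattice_point n r z) {..<n} \<Longrightarrow>
      L2_set (lattice_point n r z) {..<n} \<le> 1 \<Longrightarrow> a \<le> slab_sum n m u (lattice_point n r z)"
    and upper: "\<And>x. slab_sum n m u x \<le> b * L2_set x {..<n}" "b \<ge> 0"
    and x: "L2_set x {..<n} = 1"
  shows "a - b / r \<le> slab_sum n m u x"
proof -
  obtain z where z: "z \<in> int_vectors n (r * n)"
    "L2_set (lattice_point n r z) {..<n} \<le> L2_set x {..<n}"
    "L2_set (\<lambda>j. x j - lattice_point n r z j) {..<n} \<le> 1 / real r"
    by (rule exists_lattice_point[OF n, of r x]) (use r x in auto)
  let ?y = "lattice_point n r z"
  have "L2_set x {..<n} \<le> L2_set ?y {..<n} + L2_set (\<lambda>j. x j - ?y j) {..<n}"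
    using L2_set_triangle_ineq[of ?y "\<lambda>j. x j - ?y j" "{..<n}"] by simp
  moreover have "1 / real r \<le> 1 / 2" using r by (simp add: field_simps)
  ultimately have "1/2 \<le> L2_set ?y {..<n}" using z x by linarith
  then have "a \<le> slab_sum n m u ?y" using z x by (intro net) auto
  also have "\<dots> \<le> slab_sum n m u x + slab_sum n m u (\<lambda>j. ?y j - x j)"
    by (rule slab_sum_triangle)
  also have "slab_sum n m u (\<lambda>j. ?y j - x j) \<le> b * L2_set (\<lambda>j. ?y j - x j) {..<n}"
    by (rule upper)
  also have "L2_set (\<lambda>j. ?y j - x j) {..<n} = L2_set (\<lambda>j. x j - ?y j) {..<n}"
    by (simp add: L2_set_def power2_commute)
  also have "b * \<dots> \<le> b * (1 / real r)" using z(3) upper(2) by (rule mult_left_mono)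
  finally show ?thesis by simp
qed

lemma exp_times_thinning_rate_less_1:
  obtains c :: real where "c > 0" "exp c * thinning_rate < 1"
proof
  show "- ln thinning_rate / 2 > 0" using thinning_rate by simp
  have "exp (- ln thinning_rate / 2) * thinning_rate = exp (ln thinning_rate / 2)"
    using exp_add[of "- ln thinning_rate / 2" "ln thinning_rate"] thinning_rate by simp
  then show "exp (- ln thinning_rate / 2) * thinning_rate < 1" using thinning_rate by simp
qed

lemma slab_sum_homogeneous_bounds:
  assumes "\<And>y. L2_set y {..<n} = 1 \<Longrightarrow> a \<le> slab_sum n m u y \<and> slab_sum n m u y \<le> b"
  shows "a * L2_set x {..<n} \<le> slab_sum n m u x" "slab_sum n m u x \<le> b * L2_set x {..<n}"
proof -
  let ?s = "L2_set x {..<n}"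
  have "a * ?s \<le> slab_sum n m u x \<and> slab_sum n m u x \<le> b * ?s"
  proof (cases "?s = 0")
    case True
    then have "\<And>j. j < n \<Longrightarrow> x j = 0" by (auto simp: L2_set_eq_0_iff)
    then have "slab_sum n m u x = 0" by (simp add: slab_sum_def dot_def)
    then show ?thesis using True by simp
  next
    case False
    then have s: "?s > 0" using L2_set_nonneg[of x "{..<n}"] by linarith
    have "L2_set (\<lambda>j. (1 / ?s) * x j) {..<n} = 1"
      unfolding L2_set_scale using s by simp
    from assms[OF this] show ?thesis
      unfolding slab_sum_scale using s by (simp add: field_simps)
  qed
  then show "a * ?s \<le> slab_sum n m u x" "slab_sum n m u x \<le> b * ?s" by auto
qed

text \<open>
  Counting sign systems. The constants are chosen in the order \<open>c\<close>, \<open>r\<close>, \<open>k\<close>: first \<open>c\<close>, so small that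
  the proportion of systems with a sum below \<open>c * m\<close> at a given vector of norm between
  \<open>1/2\<close> and \<open>1\<close> is at most \<open>q ^ m\<close> with \<open>q < 1\<close>; then the fineness \<open>r\<close> of the net, so that passing from the net to the sphere costs
  at most half of \<open>c\<close>; finally \<open>k = m / n\<close>, so large that \<open>q ^ m\<close> beats the size of the net. For the
  upper bound every \<open>k \<ge> 1\<close> is large enough: the failure probability \<open>(2 * exp (-7)) ^ m\<close> already beats the
  \<open>12 ^ n\<close> points of the net of fineness 2.
\<close>

lemma exists_spread_slab_system:
  "\<exists>c>0. \<exists>k\<ge>1. \<forall>n\<ge>1. \<exists>u. \<forall>x. c * real (k * n) * L2_set x {..<n} \<le> slab_sum n (k * n) u x
      \<and> slab_sum n (k * n) u x \<le> 16 * real (k * n) * L2_set x {..<n}"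
proof -
  obtain c :: real where c: "c > 0" "exp c * thinning_rate < 1"
    by (rule exp_times_thinning_rate_less_1)
  define q where "q = exp c * thinning_rate"
  have q: "0 < q" "q < 1" using c(2) thinning_rate(1) by (simp_all add: q_def)
  obtain r :: nat where r: "r \<ge> 2" "32 / c \<le> real r"
  proof -
    obtain r0 :: nat where "32 / c \<le> real r0" using real_arch_simple by blast
    then show ?thesis by (intro that[of "r0 + 2"]) auto
  qed
  obtain k0 where k0: "q ^ k0 < 1 / (4 * (3 * 2 ^ r))"
    using real_arch_pow_inv[OF _ q(2), of "1 / (4 * (3 * 2 ^ r))"] by auto
  define k where "k = max 1 k0"
  have "q ^ k \<le> q ^ k0" unfolding k_def using q by (intro power_decreasing) auto
  then have "q ^ k \<le> 1 / (4 * (3 * 2 ^ r))" using k0 by linarith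
  then have k: "k \<ge> 1" "3 * 2 ^ r * q ^ k \<le> 1/4" by (simp_all add: k_def field_simps)
  define p :: real where "p = 2 * exp (1 - 8)"
  have p: "0 \<le> p" "12 * p \<le> 1/4"
  proof -
    show "0 \<le> p" by (simp add: p_def)
    have "(2::real) ^ 7 \<le> exp 1 ^ 7" using exp_ge_add_one_self[of 1] by (intro power_mono) auto
    also have "\<dots> = exp (7::real)" using exp_of_nat_mult[of 7 "1::real"] by simp
    finally show "12 * p \<le> 1/4" by (simp add: p_def exp_minus field_simps)
  qed
  have "\<exists>u. \<forall>x. c / 2 * real (k * n) * L2_set x {..<n} \<le> slab_sum n (k * n) u x
      \<and> slab_sum n (k * n) u x \<le> 16 * real (k * n) * L2_set x {..<n}" if n: "n \<ge> 1" for n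
  proof -
    define m where "m = k * n"
    let ?W = "sign_systems n m"
    let ?w = "real (card ?W)"
    have w: "?w > 0" by (simp add: card_sign_systems)
    define N1 where "N1 = {z \<in> int_vectors n (2 * n). L2_set (lattice_point n 2 z) {..<n} \<le> 1}"
    define N2 where "N2 = {z \<in> int_vectors n (r * n). 1/2 \<le> L2_set (lattice_point n r z) {..<n} \<and>
      L2_set (lattice_point n r z) {..<n} \<le> 1}"
    define B1 where "B1 = (\<Union>z\<in>N1. {u \<in> ?W. 8 * real m \<le> slab_sum n m u (lattice_point n 2 z)})"
    define B2 where "B2 = (\<Union>z\<in>N2. {u \<in> ?W. slab_sum n m u (lattice_point n r z) \<le> c * real m})"
    have "real (card B1) \<le> 3 ^ n * 2 ^ (2 * n) * (?w * p ^ m)"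
      unfolding B1_def p_def
      by (intro card_net_UN_le card_slab_sum_large_le) (auto simp: N1_def)
    also have "\<dots> \<le> 3 ^ n * 2 ^ (2 * n) * (?w * p ^ n)"
      using p k(1) n by (intro mult_left_mono power_decreasing) (auto simp: m_def)
    also have "\<dots> = ?w * (3 * 2 ^ 2 * p) ^ n"
      unfolding power_mult power_mult_distrib by simp
    also have "\<dots> \<le> ?w * (1/4) ^ n"
      using p by (intro mult_left_mono power_mono) auto
    also have "\<dots> \<le> ?w * (1/4) ^ 1"
      using n by (intro mult_left_mono power_decreasing) auto
    finally have 1: "real (card B1) \<le> ?w / 4" by simp
    have "real (card B2) \<le> 3 ^ n * 2 ^ (r * n) * (?w * q ^ m)"
      unfolding B2_def q_def
      by (intro card_net_UN_le card_slab_sum_small_le) (use q in \<open>auto simp: N2_def q_def\<close>)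
    also have "\<dots> = ?w * (3 * 2 ^ r * q ^ k) ^ n"
      unfolding m_def power_mult power_mult_distrib by simp
    also have "\<dots> \<le> ?w * (1/4) ^ n"
      using k q by (intro mult_left_mono power_mono) auto
    also have "\<dots> \<le> ?w * (1/4) ^ 1"
      using n by (intro mult_left_mono power_decreasing) auto
    finally have 2: "real (card B2) \<le> ?w / 4" by simp
    have "card (B1 \<union> B2) < card ?W"
      using card_Un_le[of B1 B2] 1 2 w by linarith
    moreover have "B1 \<union> B2 \<subseteq> ?W" by (auto simp: B1_def B2_def)
    ultimately obtain u where u: "u \<in> ?W" "u \<notin> B1" "u \<notin> B2"
      by (metis UnI1 UnI2 order_less_irrefl subsetI subset_antisym)
    have upper: "slab_sum n m u x \<le> 2 * (8 * real m)" if "L2_set x {..<n} \<le> 1" for x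
      by (rule slab_sum_le_of_net[OF n _ that]) (use u in \<open>force simp: B1_def N1_def\<close>)
    have upper': "slab_sum n m u x \<le> 16 * real m * L2_set x {..<n}" for x
      by (rule slab_sum_homogeneous_bounds(2)[of n 0]) (use upper in \<open>auto simp: slab_sum_def sum_nonneg\<close>)
    have "c / 2 * real m \<le> slab_sum n m u x" if x: "L2_set x {..<n} = 1" for x
    proof -
      have "c * real m - 16 * real m / r \<le> slab_sum n m u x"
        by (rule slab_sum_ge_of_net[OF n r(1) _ upper' _ x]) (use u in \<open>force simp: B2_def N2_def\<close>)+
      moreover have "16 * real m / r \<le> c / 2 * real m"
      proof -
        have "32 \<le> c * real r" using r(2) c(1) by (simp add: field_simps)
        then have "32 * real m \<le> c * real r * real m" by (rule mult_right_mono) auto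
        then show ?thesis using r(1) by (simp add: field_simps)
      qed
      ultimately show ?thesis by linarith
    qed
    then have "c / 2 * real m * L2_set x {..<n} \<le> slab_sum n m u x" for x
      using upper by (intro slab_sum_homogeneous_bounds(1)[of n _ m u "2 * (8 * real m)"]) simp
    then show ?thesis using upper' unfolding m_def by blast
  qed
  then have "\<forall>n\<ge>1. \<exists>u. \<forall>x. c / 2 * real (k * n) * L2_set x {..<n} \<le> slab_sum n (k * n) u x
      \<and> slab_sum n (k * n) u x \<le> 16 * real (k * n) * L2_set x {..<n}"
    by (intro allI impI)
  moreover have "c / 2 > 0" using c(1) by simp
  ultimately show ?thesis using k(1) by (intro exI[of _ "c / 2"] exI[of _ k] conjI)
qed

section \<open>Orthogonal invariance of Lebesgue measure on coordinate space\<close>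

abbreviation Leb :: "nat \<Rightarrow> (nat \<Rightarrow> real) measure"
  where "Leb n \<equiv> PiM {..<n} (\<lambda>_. lborel)"

interpretation lborel_prod: product_sigma_finite "\<lambda>_ :: nat. lborel :: real measure"
  by standard

lemma space_Leb: "space (Leb n) = PiE {..<n} (\<lambda>_. UNIV)"
  by (simp add: space_PiM)

lemma emeasure_Leb_box:
  "(\<And>i. i < n \<Longrightarrow> a i \<le> b i) \<Longrightarrow>
    emeasure (Leb n) (PiE {..<n} (\<lambda>i. {a i..b i})) = ennreal (\<Prod>i<n. b i - a i)"
  by (subst lborel_prod.emeasure_PiM) (auto intro!: prod_ennreal)

lemma sets_Leb_box [measurable]: "PiE {..<n} (\<lambda>i. {a i..b i}) \<in> sets (Leb n)"
  by (rule sets_PiM_I_finite) auto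

text \<open>
  Both sides are measures on the product \<open>\<sigma>\<close>-algebra, and they agree on boxes by the one-dimensional
  formula.
\<close>

lemma Leb_affine:
  assumes s: "s > 0"
  shows "density (distr (Leb n) (Leb n) (\<lambda>x. \<lambda>i\<in>{..<n}. v i + s * x i)) (\<lambda>_. ennreal (s ^ n)) = Leb n"
    (is "?P = _")
proof (rule lborel_prod.PiM_eqI)
  fix A :: "nat \<Rightarrow> real set"
  assume A: "\<And>i. i \<in> {..<n} \<Longrightarrow> A i \<in> sets lborel"
  let ?T = "\<lambda>x. \<lambda>i\<in>{..<n}. v i + s * x i"
  have T [measurable]: "?T \<in> Leb n \<rightarrow>\<^sub>M Leb n" by measurable
  have box: "PiE {..<n} A \<in> sets (Leb n)" using A by (intro sets_PiM_I_finite) auto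
  have "emeasure ?P (PiE {..<n} A) = ennreal (s ^ n) * emeasure (Leb n) (?T -` PiE {..<n} A \<inter> space (Leb n))"
    using box by (simp add: emeasure_density_const emeasure_distr)
  also have "?T -` PiE {..<n} A \<inter> space (Leb n) = PiE {..<n} (\<lambda>i. (\<lambda>y. v i + s * y) -` A i)"
    by (auto simp: space_Leb PiE_def Pi_def extensional_def)
  also have "emeasure (Leb n) \<dots> = (\<Prod>i<n. emeasure lborel ((\<lambda>y. v i + s * y) -` A i))"
    using A by (intro lborel_prod.emeasure_PiM) (auto intro!: measurable_sets_borel[where M=borel])
  also have "ennreal (s ^ n) * \<dots> = (\<Prod>i<n. ennreal s * emeasure lborel ((\<lambda>y. v i + s * y) -` A i))"
    using s by (simp add: prod.distrib ennreal_power)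
  also have "\<dots> = (\<Prod>i<n. emeasure lborel (A i))"
  proof (rule prod.cong[OF refl])
    fix i assume "i \<in> {..<n}"
    then have Ai: "A i \<in> sets borel" using A by auto
    have "emeasure lborel (A i) = emeasure (density (distr lborel borel (\<lambda>x. v i + s * x)) (\<lambda>_. ennreal \<bar>s\<bar>)) (A i)"
      using s by (subst lborel_real_affine[of s "v i"]) auto
    also have "\<dots> = ennreal s * emeasure lborel ((\<lambda>y. v i + s * y) -` A i)"
      using Ai s by (simp add: emeasure_density_const emeasure_distr)
    finally show "ennreal s * emeasure lborel ((\<lambda>y. v i + s * y) -` A i) = emeasure lborel (A i)" ..
  qed
  finally show "emeasure ?P (PiE {..<n} A) = (\<Prod>i<n. emeasure lborel (A i))" .
qed auto

lemma nn_integral_Leb_affine: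
  assumes [measurable]: "f \<in> borel_measurable (Leb n)" and s: "s > 0"
  shows "(\<integral>\<^sup>+x. f x \<partial>Leb n) = ennreal (s ^ n) * (\<integral>\<^sup>+x. f (\<lambda>i\<in>{..<n}. v i + s * x i) \<partial>Leb n)"
  by (subst Leb_affine[OF s, of n v, symmetric])
     (simp add: nn_integral_density nn_integral_distr nn_integral_cmult)

lemma nn_integral_Leb_translate:
  assumes "f \<in> borel_measurable (Leb n)"
  shows "(\<integral>\<^sup>+x. f (\<lambda>i\<in>{..<n}. x i + v i) \<partial>Leb n) = (\<integral>\<^sup>+x. f x \<partial>Leb n)"
  using nn_integral_Leb_affine[OF assms, of 1 v] by (simp add: add.commute)

lemma sum_rotate:
  "(\<Sum>a\<in>A. \<Sum>j\<in>J. \<Sum>k\<in>K. f a j k) = (\<Sum>j\<in>J. \<Sum>k\<in>K. \<Sum>a\<in>A. f a j k)"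
proof -
  have "(\<Sum>a\<in>A. \<Sum>j\<in>J. \<Sum>k\<in>K. f a j k) = (\<Sum>j\<in>J. \<Sum>a\<in>A. \<Sum>k\<in>K. f a j k)"
    by (rule sum.swap)
  also have "\<dots> = (\<Sum>j\<in>J. \<Sum>k\<in>K. \<Sum>a\<in>A. f a j k)"
    by (intro sum.cong refl sum.swap)
  finally show ?thesis .
qed

text \<open>
  A square matrix with orthonormal rows has orthonormal columns. With \<open>P\<close> the Gram matrix of the
  columns, the trace of \<open>P\<close> and the sum of the squares of its entries are both \<open>n\<close>, so the squared
  Frobenius distance of \<open>P\<close> from the identity is \<open>n - 2 * n + n = 0\<close>.
\<close>

lemma orthonormal_columns:
  assumes w: "\<And>j k. j < n \<Longrightarrow> k < n \<Longrightarrow> dot n (w j) (w k) = (if j = k then 1 else 0)"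
    and "a < n" "b < n"
  shows "(\<Sum>j<n. w j a * w j b) = (if a = b then 1 else 0)"
proof -
  define P where "P = (\<lambda>a b. \<Sum>j<n. w j a * w j b)"
  define I :: "nat \<Rightarrow> nat \<Rightarrow> real" where "I = (\<lambda>a b. if a = b then 1 else 0)"
  have tr: "(\<Sum>a<n. P a a) = n"
    unfolding P_def by (subst sum.swap) (use w in \<open>simp add: dot_def\<close>)
  \<comment> \<open>Regrouping this fourfold sum by the rows turns it into the squared Frobenius norm of the Gram matrix of
    the rows, which is the identity.\<close>
  have "(\<Sum>a<n. \<Sum>b<n. P a b * P a b) = (\<Sum>a<n. \<Sum>b<n. \<Sum>j<n. \<Sum>k<n. w j a * w j b * (w k a * w k b))"
    by (simp add: P_def sum_product)
  also have "\<dots> = (\<Sum>a<n. \<Sum>j<n. \<Sum>k<n. \<Sum>b<n. w j a * w j b * (w k a * w k b))"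
    by (intro sum.cong[OF refl] sum_rotate)
  also have "\<dots> = (\<Sum>j<n. \<Sum>k<n. \<Sum>a<n. \<Sum>b<n. w j a * w j b * (w k a * w k b))"
    by (rule sum_rotate)
  also have "\<dots> = (\<Sum>j<n. \<Sum>k<n. dot n (w j) (w k) * dot n (w j) (w k))"
    by (simp add: dot_def sum_product algebra_simps)
  also have "\<dots> = (\<Sum>j<n. \<Sum>k<n. if j = k then 1 else 0)"
    using w by (intro sum.cong) auto
  also have "\<dots> = n" by simp
  finally have PP: "(\<Sum>a<n. \<Sum>b<n. P a b * P a b) = n" .
  have "(\<Sum>a<n. \<Sum>b<n. (P a b - I a b)\<^sup>2)
      = (\<Sum>a<n. \<Sum>b<n. P a b * P a b) - 2 * (\<Sum>a<n. \<Sum>b<n. P a b * I a b) + (\<Sum>a<n. \<Sum>b<n. I a b * I a b)"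
    by (simp add: power2_eq_square algebra_simps sum.distrib sum_subtractf sum_distrib_left)
  also have "\<dots> = 0" using PP tr by (simp add: I_def if_distrib cong: if_cong)
  finally have "(\<Sum>a<n. \<Sum>b<n. (P a b - I a b)\<^sup>2) = 0" .
  then have "(P a b - I a b)\<^sup>2 = 0" if "a < n" "b < n" for a b
    using that by (simp add: sum_nonneg_eq_0_iff sum_nonneg)
  then show ?thesis using assms(2,3) by (simp add: P_def I_def)
qed

text \<open>
  The linear map that sends the \<open>j\<close>-th standard unit vector to \<open>w j\<close>.
\<close>

definition in_basis :: "nat \<Rightarrow> (nat \<Rightarrow> nat \<Rightarrow> real) \<Rightarrow> (nat \<Rightarrow> real) \<Rightarrow> (nat \<Rightarrow> real)"
  where "in_basis n w x = (\<lambda>i\<in>{..<n}. \<Sum>j<n. x j * w j i)"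

lemma measurable_in_basis [measurable]: "in_basis n w \<in> Leb n \<rightarrow>\<^sub>M Leb n"
  unfolding in_basis_def by measurable

lemma measurable_dot_Leb [measurable]: "(\<lambda>x. dot n x v) \<in> borel_measurable (Leb n)"
  unfolding dot_def by measurable

lemma in_basis_inverse:
  assumes w: "\<And>j k. j < n \<Longrightarrow> k < n \<Longrightarrow> dot n (w j) (w k) = (if j = k then 1 else 0)"
    and i: "i < n"
  shows "(\<Sum>j<n. dot n x (w j) * w j i) = x i"
proof -
  have "(\<Sum>j<n. dot n x (w j) * w j i) = (\<Sum>a<n. x a * (\<Sum>j<n. w j a * w j i))"
    unfolding dot_def sum_distrib_right sum_distrib_left
    by (subst sum.swap) (simp add: mult.assoc)
  also have "\<dots> = (\<Sum>a<n. x a * (if a = i then 1 else 0))"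
    using orthonormal_columns[OF w] i by (intro sum.cong) auto
  also have "\<dots> = x i" using i by (simp add: if_distrib cong: if_cong)
  finally show ?thesis .
qed

lemma dot_in_basis:
  assumes w: "\<And>j k. j < n \<Longrightarrow> k < n \<Longrightarrow> dot n (w j) (w k) = (if j = k then 1 else 0)"
  shows "dot n (in_basis n w x) (in_basis n w x) = dot n x x"
proof -
  have "dot n (in_basis n w x) (in_basis n w x)
      = (\<Sum>i<n. \<Sum>j<n. \<Sum>k<n. x j * w j i * (x k * w k i))"
    by (simp add: dot_def in_basis_def sum_product)
  also have "\<dots> = (\<Sum>j<n. \<Sum>k<n. \<Sum>i<n. x j * w j i * (x k * w k i))"
    by (rule sum_rotate)
  also have "\<dots> = (\<Sum>j<n. \<Sum>k<n. x j * x k * dot n (w j) (w k))"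
    by (simp add: dot_def sum_distrib_left algebra_simps)
  also have "\<dots> = (\<Sum>j<n. \<Sum>k<n. if j = k then x j * x k else 0)"
    using w by (intro sum.cong) auto
  also have "\<dots> = dot n x x" by (simp add: dot_def)
  finally show ?thesis .
qed

lemma emeasure_unit_ball_Leb:
  "emeasure (Leb n) {x \<in> space (Leb n). dot n x x \<le> 1} \<noteq> 0"
  "emeasure (Leb n) {x \<in> space (Leb n). dot n x x \<le> 1} \<noteq> \<infinity>"
proof -
  let ?A = "{x \<in> space (Leb n). dot n x x \<le> 1}"
  have A [measurable]: "?A \<in> sets (Leb n)" unfolding dot_def by measurable
  \<comment> \<open>A cube of half-side \<open>a\<close> lies in the ball, as \<open>n * a\<^sup>2 \<le> n * a \<le> 1\<close>; the summand 1 covers \<open>n = 0\<close>.\<close>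
  define a where "a = 1 / (real n + 1)"
  have a: "0 < a" "a \<le> 1" "real n * a \<le> 1" by (simp_all add: a_def field_simps)
  have "PiE {..<n} (\<lambda>_. {- a..a}) \<subseteq> ?A"
  proof
    fix x assume x: "x \<in> PiE {..<n} (\<lambda>_. {- a..a})"
    have "dot n x x \<le> (\<Sum>i<n. a)"
      unfolding dot_def
    proof (rule sum_mono)
      fix i assume "i \<in> {..<n}"
      then have "x i \<in> {- a..a}" using x by (rule PiE_mem[rotated])
      then have "\<bar>x i\<bar> \<le> a" by auto
      then have "\<bar>x i\<bar> * \<bar>x i\<bar> \<le> a * 1" using a by (intro mult_mono) linarith+
      then show "x i * x i \<le> a" by simp
    qed
    also have "\<dots> \<le> 1" using a by simp
    finally show "x \<in> ?A" using x by (auto simp: space_Leb)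
  qed
  then have "emeasure (Leb n) (PiE {..<n} (\<lambda>_. {- a..a})) \<le> emeasure (Leb n) ?A"
    by (intro emeasure_mono) auto
  moreover have "emeasure (Leb n) (PiE {..<n} (\<lambda>_. {- a..a})) > 0"
    using a by (subst emeasure_Leb_box) (auto intro!: prod_pos)
  ultimately show "emeasure (Leb n) ?A \<noteq> 0" by auto
  have "?A \<subseteq> PiE {..<n} (\<lambda>_. {- 1..1})"
  proof
    fix x assume x: "x \<in> ?A"
    have "\<bar>x i\<bar> \<le> 1" if "i < n" for i
    proof -
      have "x i * x i \<le> dot n x x" unfolding dot_def using that
        by (intro member_le_sum[of i "{..<n}" "\<lambda>i. x i * x i"]) auto
      then show ?thesis using x abs_square_le_1[of "x i"] by (simp add: power2_eq_square)
    qed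
    then show "x \<in> PiE {..<n} (\<lambda>_. {- 1..1})" using x
      by (auto simp: space_Leb PiE_def Pi_def abs_le_iff minus_le_iff)
  qed
  then have "emeasure (Leb n) ?A \<le> emeasure (Leb n) (PiE {..<n} (\<lambda>_. {- 1..1}))"
    by (intro emeasure_mono) auto
  also have "\<dots> < \<infinity>" by (subst emeasure_Leb_box) auto
  finally show "emeasure (Leb n) ?A \<noteq> \<infinity>" by auto
qed

text \<open>
  Uniqueness of translation invariant measures, in a form that gives the constant at once. Let \<open>\<Phi>\<close> be
  the orthogonal map and \<open>A\<close> the unit ball. The double integral of \<open>1\<^sub>A(x) 1\<^sub>B(x + \<Phi> y)\<close> is
  \<open>|A| |\<Phi>\<^sup>-\<^sup>1 B|\<close> if \<open>y\<close> is integrated first. If \<open>x\<close> is integrated first, the substitution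
  \<open>x \<mapsto> x - \<Phi> y\<close> turns it into the integral of \<open>1\<^sub>A(x - \<Phi> y) 1\<^sub>B(x)\<close>, which is \<open>|A| |B|\<close> because
  \<open>\<Phi>\<close> preserves the ball. It remains to cancel \<open>|A|\<close>.
\<close>

lemma emeasure_in_basis:
  assumes w: "\<And>j k. j < n \<Longrightarrow> k < n \<Longrightarrow> dot n (w j) (w k) = (if j = k then 1 else 0)"
    and B [measurable]: "B \<in> sets (Leb n)"
  shows "(\<integral>\<^sup>+x. indicator B (in_basis n w x) \<partial>Leb n) = emeasure (Leb n) B"
proof -
  interpret pair_sigma_finite "Leb n" "Leb n"
    by (intro pair_sigma_finite.intro lborel_prod.sigma_finite) auto
  let ?M = "Leb n" and ?\<Phi> = "in_basis n w"
  define A where "A = {x \<in> space (Leb n). dot n x x \<le> 1}"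
  have A [measurable]: "A \<in> sets ?M" unfolding A_def dot_def by measurable
  let ?f = "indicator A :: _ \<Rightarrow> ennreal" and ?g = "indicator B :: _ \<Rightarrow> ennreal"
  define add :: "(nat \<Rightarrow> real) \<Rightarrow> (nat \<Rightarrow> real) \<Rightarrow> nat \<Rightarrow> real" where "add = (\<lambda>x y. \<lambda>i\<in>{..<n}. x i + y i)"
  define sub :: "(nat \<Rightarrow> real) \<Rightarrow> (nat \<Rightarrow> real) \<Rightarrow> nat \<Rightarrow> real" where "sub = (\<lambda>x y. \<lambda>i\<in>{..<n}. x i - y i)"
  define inv where "inv = (\<lambda>x. \<lambda>j\<in>{..<n}. dot n x (w j))"
  have comp: "(\<lambda>p. fst p i) \<in> borel_measurable (?M \<Otimes>\<^sub>M ?M)"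
    "(\<lambda>p. ?\<Phi> (snd p) i) \<in> borel_measurable (?M \<Otimes>\<^sub>M ?M)"
    "(\<lambda>x. x i) \<in> borel_measurable ?M" "(\<lambda>x. ?\<Phi> x i) \<in> borel_measurable ?M"
    if "i \<in> {..<n}" for i
  proof -
    have c: "(\<lambda>x. x i) \<in> borel_measurable ?M"
      using measurable_component_singleton[OF that, of "\<lambda>_. lborel"] by simp
    then show "(\<lambda>x. x i) \<in> borel_measurable ?M" .
    from c show "(\<lambda>p. fst p i) \<in> borel_measurable (?M \<Otimes>\<^sub>M ?M)"
      by (rule measurable_compose[OF measurable_fst])
    from c show "(\<lambda>x. ?\<Phi> x i) \<in> borel_measurable ?M"
      by (rule measurable_compose[OF measurable_in_basis])
    then show "(\<lambda>p. ?\<Phi> (snd p) i) \<in> borel_measurable (?M \<Otimes>\<^sub>M ?M)"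
      by (rule measurable_compose[OF measurable_snd])
  qed
  have [measurable]: "(\<lambda>p. add (fst p) (?\<Phi> (snd p))) \<in> ?M \<Otimes>\<^sub>M ?M \<rightarrow>\<^sub>M ?M"
    "(\<lambda>p. sub (fst p) (?\<Phi> (snd p))) \<in> ?M \<Otimes>\<^sub>M ?M \<rightarrow>\<^sub>M ?M"
    unfolding add_def sub_def using comp
    by (auto intro!: measurable_restrict borel_measurable_add borel_measurable_diff)
  have [measurable]: "\<And>y. (\<lambda>x. add x y) \<in> ?M \<rightarrow>\<^sub>M ?M" "\<And>y. (\<lambda>x. sub x y) \<in> ?M \<rightarrow>\<^sub>M ?M"
    "\<And>x. (\<lambda>y. sub x (?\<Phi> y)) \<in> ?M \<rightarrow>\<^sub>M ?M" "\<And>x. (\<lambda>y. add x (?\<Phi> y)) \<in> ?M \<rightarrow>\<^sub>M ?M"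
    unfolding add_def sub_def using comp
    by (auto intro!: measurable_restrict borel_measurable_add borel_measurable_diff)
  have \<Phi>_add: "?\<Phi> (add y (inv x)) = add x (?\<Phi> y)" for x y
  proof
    fix i
    show "?\<Phi> (add y (inv x)) i = add x (?\<Phi> y) i"
    proof (cases "i < n")
      case True
      have "(\<Sum>j<n. add y (inv x) j * w j i) = (\<Sum>j<n. dot n x (w j) * w j i + y j * w j i)"
        by (intro sum.cong) (auto simp: add_def inv_def distrib_right)
      then show ?thesis
        using True in_basis_inverse[OF w True, of x] by (simp add: sum.distrib) (simp add: in_basis_def add_def)
    qed (simp add: in_basis_def add_def)
  qed
  have trans: "(\<integral>\<^sup>+x. h (add x v) \<partial>?M) = (\<integral>\<^sup>+x. h x \<partial>?M)" if "h \<in> borel_measurable ?M" for h v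
    unfolding add_def using nn_integral_Leb_translate[OF that] by simp
  have "emeasure ?M A * (\<integral>\<^sup>+y. ?g (?\<Phi> y) \<partial>?M) = (\<integral>\<^sup>+x. ?f x * (\<integral>\<^sup>+y. ?g (?\<Phi> y) \<partial>?M) \<partial>?M)"
    by (simp add: nn_integral_multc)
  also have "\<dots> = (\<integral>\<^sup>+x. ?f x * (\<integral>\<^sup>+y. ?g (add x (?\<Phi> y)) \<partial>?M) \<partial>?M)"
  proof (rule arg_cong[where f="integral\<^sup>N ?M"], rule ext)
    fix x
    have "(\<integral>\<^sup>+y. ?g (?\<Phi> y) \<partial>?M) = (\<integral>\<^sup>+y. ?g (?\<Phi> (add y (inv x))) \<partial>?M)"
      by (rule trans[symmetric]) measurable
    then show "?f x * (\<integral>\<^sup>+y. ?g (?\<Phi> y) \<partial>?M) = ?f x * (\<integral>\<^sup>+y. ?g (add x (?\<Phi> y)) \<partial>?M)"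
      by (simp only: \<Phi>_add)
  qed
  also have "\<dots> = (\<integral>\<^sup>+x. \<integral>\<^sup>+y. ?f x * ?g (add x (?\<Phi> y)) \<partial>?M \<partial>?M)"
    by (intro nn_integral_cong nn_integral_cmult[symmetric]) measurable
  also have "\<dots> = (\<integral>\<^sup>+y. \<integral>\<^sup>+x. ?f x * ?g (add x (?\<Phi> y)) \<partial>?M \<partial>?M)"
    by (rule Fubini'[symmetric]) measurable
  also have "\<dots> = (\<integral>\<^sup>+y. \<integral>\<^sup>+x. ?f (sub x (?\<Phi> y)) * ?g x \<partial>?M \<partial>?M)"
  proof (rule nn_integral_cong)
    fix y
    have "(\<integral>\<^sup>+x. ?f x * ?g (add x (?\<Phi> y)) \<partial>?M)
        = (\<integral>\<^sup>+x. ?f (sub (add x (?\<Phi> y)) (?\<Phi> y)) * ?g (add x (?\<Phi> y)) \<partial>?M)"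
    proof (rule nn_integral_cong)
      fix x assume "x \<in> space ?M"
      then have "sub (add x (?\<Phi> y)) (?\<Phi> y) = x"
        by (auto simp: sub_def add_def space_Leb PiE_def extensional_def fun_eq_iff)
      then show "?f x * ?g (add x (?\<Phi> y)) = ?f (sub (add x (?\<Phi> y)) (?\<Phi> y)) * ?g (add x (?\<Phi> y))"
        by simp
    qed
    also have "\<dots> = (\<integral>\<^sup>+x. ?f (sub x (?\<Phi> y)) * ?g x \<partial>?M)"
      by (rule trans) measurable
    finally show "(\<integral>\<^sup>+x. ?f x * ?g (add x (?\<Phi> y)) \<partial>?M) = (\<integral>\<^sup>+x. ?f (sub x (?\<Phi> y)) * ?g x \<partial>?M)" .
  qed
  also have "\<dots> = (\<integral>\<^sup>+x. \<integral>\<^sup>+y. ?f (sub x (?\<Phi> y)) * ?g x \<partial>?M \<partial>?M)"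
    by (rule Fubini') measurable
  also have "\<dots> = (\<integral>\<^sup>+x. emeasure ?M A * ?g x \<partial>?M)"
  proof (rule nn_integral_cong)
    fix x
    have "(\<integral>\<^sup>+y. ?f (sub x (?\<Phi> y)) \<partial>?M) = (\<integral>\<^sup>+y. ?f (sub x (?\<Phi> (add y (inv x)))) \<partial>?M)"
      by (rule trans[symmetric]) measurable
    also have "\<dots> = (\<integral>\<^sup>+y. ?f y \<partial>?M)"
    proof (rule nn_integral_cong)
      fix y assume y: "y \<in> space ?M"
      have "sub x (add x (?\<Phi> y)) = (\<lambda>i\<in>{..<n}. - ?\<Phi> y i)"
        by (auto simp: sub_def add_def)
      moreover have "(\<lambda>i\<in>{..<n}. - ?\<Phi> y i) \<in> A \<longleftrightarrow> y \<in> A"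
        using y dot_in_basis[OF w, of y] by (auto simp: A_def space_Leb dot_def)
      ultimately show "?f (sub x (?\<Phi> (add y (inv x)))) = ?f y"
        unfolding \<Phi>_add by (simp add: indicator_def)
    qed
    finally show "(\<integral>\<^sup>+y. ?f (sub x (?\<Phi> y)) * ?g x \<partial>?M) = emeasure ?M A * ?g x"
      by (simp add: nn_integral_multc)
  qed
  also have "\<dots> = emeasure ?M A * emeasure ?M B"
    by (simp add: nn_integral_cmult)
  finally show ?thesis
    using emeasure_unit_ball_Leb[of n] unfolding A_def[symmetric]
    by (simp add: ennreal_mult_cancel_left top_unique)
qed

section \<open>Overlap with a translate versus shadow\<close>

definition zero_ext :: "nat \<Rightarrow> (nat \<Rightarrow> real) \<Rightarrow> nat \<Rightarrow> real"
  where "zero_ext n x = (\<lambda>i. if i < n then x i else 0)"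

text \<open>
  Subsets of the Euclidean space consist of functions that vanish from index \<open>n\<close> on, while the product
  measure lives on functions that are undefined there.
\<close>

definition coords :: "nat \<Rightarrow> (nat \<Rightarrow> real) set \<Rightarrow> (nat \<Rightarrow> real) set"
  where "coords n A = {x \<in> space (Leb n). zero_ext n x \<in> A}"

lemma vol_eq_measure_coords:
  assumes "A \<subseteq> topspace (Euclidean_space n)"
  shows "vol n A = measure (Leb n) (coords n A)"
proof -
  have "(\<lambda>x. restrict x {..<n}) ` A = coords n A"
  proof (intro equalityI subsetI)
    fix y assume "y \<in> (\<lambda>x. restrict x {..<n}) ` A"
    then obtain x where x: "x \<in> A" "y = restrict x {..<n}" by auto
    have "zero_ext n y = x"
      using x assms by (fastforce simp: zero_ext_def topspace_Euclidean_space fun_eq_iff)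
    then show "y \<in> coords n A" using x by (simp add: coords_def space_Leb)
  next
    fix y assume y: "y \<in> coords n A"
    then have "y = restrict (zero_ext n y) {..<n}"
      by (auto simp: coords_def space_Leb zero_ext_def PiE_def extensional_def fun_eq_iff)
    moreover have "zero_ext n y \<in> A" using y by (simp add: coords_def)
    ultimately show "y \<in> (\<lambda>x. restrict x {..<n}) ` A" by (rule image_eqI)
  qed
  then show ?thesis by (simp add: vol_def)
qed

lemma measurable_zero_ext [measurable]: "zero_ext n \<in> Leb n \<rightarrow>\<^sub>M borel"
proof -
  have "(\<lambda>x i. if i < n then x i else 0) \<in> Leb n \<rightarrow>\<^sub>M PiM UNIV (\<lambda>_. borel)"
  proof (rule measurable_abs_UNIV)
    fix i show "(\<lambda>x. if i < n then x i else 0) \<in> borel_measurable (Leb n)"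
      using measurable_component_singleton[of i "{..<n}" "\<lambda>_. lborel"] by (cases "i < n") simp_all
  qed
  then show ?thesis
    unfolding zero_ext_def[abs_def] by (simp add: sets_PiM_equal_borel cong: measurable_cong_sets)
qed

lemma sets_coords [measurable]: "A \<in> sets borel \<Longrightarrow> coords n A \<in> sets (Leb n)"
  using measurable_sets[OF measurable_zero_ext, of A n] by (simp add: coords_def vimage_def Int_def conj_commute)

lemma continuous_on_coordinate [continuous_intros]:
  fixes S :: "('i \<Rightarrow> 'a :: topological_space) set"
  shows "continuous_on S (\<lambda>x. x i)"
  by (rule continuous_on_subset[OF continuous_on_product_coordinates]) auto

lemma emeasure_coords_compact:
  assumes "compact C"
  shows "emeasure (Leb n) (coords n C) < \<infinity>"
proof -
  have "\<exists>b. \<forall>x\<in>C. \<bar>x i\<bar> \<le> b" for i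
  proof -
    have "compact ((\<lambda>x. x i) ` C)"
      using assms by (intro compact_continuous_image continuous_on_coordinate)
    then show ?thesis using compact_imp_bounded by (force simp: bounded_iff)
  qed
  then obtain b where b: "\<And>x i. x \<in> C \<Longrightarrow> \<bar>x i\<bar> \<le> b i" by metis
  have "x i \<in> {- \<bar>b i\<bar>..\<bar>b i\<bar>}" if "x \<in> coords n C" "i < n" for x i
    using b[of "zero_ext n x" i] that by (auto simp: coords_def zero_ext_def)
  then have "coords n C \<subseteq> PiE {..<n} (\<lambda>i. {- \<bar>b i\<bar>..\<bar>b i\<bar>})"
    by (auto simp: coords_def space_Leb PiE_def Pi_def)
  then have "emeasure (Leb n) (coords n C) \<le> emeasure (Leb n) (PiE {..<n} (\<lambda>i. {- \<bar>b i\<bar>..\<bar>b i\<bar>}))"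
    by (intro emeasure_mono) auto
  also have "\<dots> < \<infinity>" by (subst emeasure_Leb_box) auto
  finally show ?thesis .
qed

text \<open>
  If \<open>s\<close> belongs to the interval \<open>I\<close> and \<open>s - t\<close> does not, then no point of \<open>I\<close> lies below \<open>s - t\<close>.
  Hence all these \<open>s\<close> lie within \<open>t\<close> of the infimum of \<open>I\<close>.
\<close>

lemma emeasure_diff_translate_le:
  fixes I :: "real set"
  assumes I: "\<And>x y z. x \<in> I \<Longrightarrow> z \<in> I \<Longrightarrow> x \<le> y \<Longrightarrow> y \<le> z \<Longrightarrow> y \<in> I" and t: "t \<ge> 0"
  shows "emeasure lborel {s \<in> I. s - t \<notin> I} \<le> ennreal t"
proof (cases "{s \<in> I. s - t \<notin> I} = {}")
  case True
  then show ?thesis by (simp del: Collect_empty_eq)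
next
  case False
  then obtain s0 where s0: "s0 \<in> I" "s0 - t \<notin> I" by auto
  have le: "s \<le> x + t" if "s \<in> I" "s - t \<notin> I" "x \<in> I" for s x
    using I[of x s "s - t"] that t by (cases "s \<le> x + t") auto
  have bdd: "bdd_below I" using le[OF s0] by (intro bdd_belowI[of _ "s0 - t"]) (auto simp: algebra_simps)
  have "{s \<in> I. s - t \<notin> I} \<subseteq> {Inf I..Inf I + t}"
  proof
    fix s assume "s \<in> {s \<in> I. s - t \<notin> I}"
    then have s: "s \<in> I" "s - t \<notin> I" by auto
    have "s - t \<le> Inf I" using le[OF s] s0 by (intro cInf_greatest) (auto simp: algebra_simps)
    moreover have "Inf I \<le> s" using s bdd by (intro cInf_lower)
    ultimately show "s \<in> {Inf I..Inf I + t}" by auto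
  qed
  then have "emeasure lborel {s \<in> I. s - t \<notin> I} \<le> emeasure lborel {Inf I..Inf I + t}"
    by (intro emeasure_mono) auto
  then show ?thesis using t by simp
qed

text \<open>
  Fubini's theorem in an orthonormal basis that consists of the chosen basis of the hyperplane and
  \<open>\<theta>\<close>: the lines in direction \<open>\<theta>\<close> that meet \<open>K\<close> are indexed by the shadow, and on each of them the
  part of \<open>K\<close> outside the translate has length at most \<open>t\<close>.
\<close>

lemma vol_le_overlap_plus_shadow:
  assumes n: "n \<ge> 1" and \<theta>: "unit_vector n \<theta>" and K: "compact K" "convex_set K"
    "K \<subseteq> topspace (Euclidean_space n)" and t: "t \<ge> 0"
  shows "vol n K \<le> vol n {x \<in> K. (\<lambda>i. x i - t * \<theta> i) \<in> K} + t * hyperplane_vol n \<theta> (proj n \<theta> ` K)"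
proof -
  define p where "p = n - 1"
  have np: "n = Suc p" using n by (simp add: p_def)
  define u where "u = (SOME u. orthonormal_basis_of_hyperplane n \<theta> u)"
  have u: "orthonormal_basis_of_hyperplane n \<theta> u"
    unfolding u_def using ex_orthonormal_basis_of_hyperplane[OF n \<theta>] by (rule someI_ex)
  define w where "w = u(p := \<theta>)"
  have uu: "dot n (u j) (u k) = (if j = k then 1 else 0)" if "j < p" "k < p" for j k
    using u that by (simp add: orthonormal_basis_of_hyperplane_def p_def)
  have u\<theta>: "dot n (u j) \<theta> = 0" and u0: "i \<ge> n \<Longrightarrow> u j i = 0" if "j < p" for j i
    using u that
    by (simp_all add: orthonormal_basis_of_hyperplane_def hyperplane_def p_def topspace_Euclidean_space)
  have \<theta>\<theta>: "dot n \<theta> \<theta> = 1" and \<theta>0: "i \<ge> n \<Longrightarrow> \<theta> i = 0" for i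
    using \<theta> by (simp_all add: unit_vector_def topspace_Euclidean_space)
  have \<theta>u: "dot n \<theta> (u j) = 0" if "j < p" for j
    using u\<theta>[OF that] by (simp only: dot_commute[of n \<theta>])
  have less_n: "j < n \<longleftrightarrow> j < p \<or> j = p" for j by (auto simp: np)
  have w: "dot n (w j) (w k) = (if j = k then 1 else 0)" if "j < n" "k < n" for j k
    using that[unfolded less_n] by (auto simp: w_def uu u\<theta> \<theta>\<theta> \<theta>u)
  have w0: "w j i = 0" if "j < n" "i \<ge> n" for i j
    using that(1)[unfolded less_n] that(2) by (auto simp: w_def u0 \<theta>0)
  have K0: "x i = 0" if "x \<in> K" "i \<ge> n" for x i
    using K(3) that by (auto simp: topspace_Euclidean_space)
  define C where "C = {c \<in> topspace (Euclidean_space p). (\<lambda>i. \<Sum>j<p. c j * u j i) \<in> proj n \<theta> ` K}"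
  have hv: "hyperplane_vol n \<theta> (proj n \<theta> ` K) = vol p C"
    unfolding hyperplane_vol_def Let_def u_def[symmetric] p_def[symmetric] C_def ..
  have expand: "x i = (\<Sum>j<p. dot n x (u j) * u j i) + dot n x \<theta> * \<theta> i" if "x \<in> K" for x i
  proof -
    have "x i = (\<Sum>j<n. dot n x (w j) * w j i)"
    proof (cases "i < n")
      case True
      show ?thesis by (rule in_basis_inverse[OF w True, symmetric])
    next
      case False
      then show ?thesis using K0[OF that, of i] w0 by simp
    qed
    then show ?thesis unfolding np by (simp add: w_def)
  qed
  \<comment> \<open>The shadow in coordinates is a continuous image of \<open>K\<close>. This gives its compactness, and with it
    measurability and finite measure.\<close>
  have C_eq: "C = (\<lambda>x j. if j < p then dot n x (u j) else 0) ` K" (is "_ = ?g ` K")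
  proof (intro equalityI subsetI)
    fix c assume c: "c \<in> C"
    then obtain x where x: "x \<in> K" "(\<lambda>i. \<Sum>j<p. c j * u j i) = proj n \<theta> x" by (auto simp: C_def)
    have "dot n x (u k) = c k" if k: "k < p" for k
    proof -
      have "dot n x (u k) = dot n (proj n \<theta> x) (u k) + dot n x \<theta> * dot n \<theta> (u k)"
        by (simp add: proj_def dot_def[of n _ "u k"] left_diff_distrib sum_subtractf sum_distrib_left mult.assoc)
      also have "\<dots> = dot n (\<lambda>i. \<Sum>j<p. c j * u j i) (u k)" using x \<theta>u[OF k] by simp
      also have "\<dots> = (\<Sum>j<p. c j * dot n (u j) (u k))"
        unfolding dot_def sum_distrib_right sum_distrib_left by (subst sum.swap) (simp add: mult.assoc)
      also have "\<dots> = (\<Sum>j<p. c j * (if j = k then 1 else 0))"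
        using uu k by (intro sum.cong) auto
      also have "\<dots> = c k" using k by (simp add: if_distrib cong: if_cong)
      finally show ?thesis .
    qed
    then have "c = ?g x" using c by (auto simp: C_def topspace_Euclidean_space fun_eq_iff)
    then show "c \<in> ?g ` K" using x by auto
  next
    fix c assume "c \<in> ?g ` K"
    then obtain x where x: "x \<in> K" "c = ?g x" by auto
    have "(\<lambda>i. \<Sum>j<p. c j * u j i) = proj n \<theta> x"
    proof
      fix i
      have "(\<Sum>j<p. c j * u j i) = (\<Sum>j<p. dot n x (u j) * u j i)"
        by (intro sum.cong) (simp_all add: x(2))
      then show "(\<Sum>j<p. c j * u j i) = proj n \<theta> x i"
        using expand[OF x(1), of i] by (simp only: proj_def)
    qed
    then show "c \<in> C" using x by (auto simp: C_def topspace_Euclidean_space)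
  qed
  have "continuous_on K ?g"
  proof (rule continuous_on_coordinatewise_then_product)
    fix j show "continuous_on K (\<lambda>x. ?g x j)"
      unfolding dot_def by (cases "j < p") (simp_all, intro continuous_intros)
  qed
  then have C: "compact C" unfolding C_eq using K(1) by (rule compact_continuous_image)
  define V where "V = {x \<in> K. (\<lambda>i. x i - t * \<theta> i) \<in> K}"
  have "closed K" using K(1) by (rule compact_imp_closed)
  have V: "closed V"
  proof -
    have "closed ((\<lambda>x i. x i - t * \<theta> i) -` K \<inter> K)"
      using \<open>closed K\<close>
      by (intro closed_Int closed_vimage continuous_on_coordinatewise_then_product continuous_intros)
    then show ?thesis by (simp add: V_def vimage_def Int_def conj_commute)
  qed
  have meas [measurable]: "K \<in> sets borel" "V \<in> sets borel" "C \<in> sets borel"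
    using \<open>closed K\<close> V compact_imp_closed[OF C] by (auto intro: borel_closed)
  let ?D = "coords n K - coords n V"
  have D [measurable]: "?D \<in> sets (Leb n)" using meas by (intro sets.Diff sets_coords)
  have "emeasure (Leb n) ?D = (\<integral>\<^sup>+x. indicator ?D (in_basis n w x) \<partial>Leb n)"
    by (rule emeasure_in_basis[OF w D, symmetric])
  also have "\<dots> = (\<integral>\<^sup>+c. \<integral>\<^sup>+s. indicator ?D (in_basis n w (c(p := s))) \<partial>lborel \<partial>Leb p)"
  proof -
    have n': "{..<n} = insert p {..<p}" by (auto simp: np)
    have "(\<lambda>x. indicator ?D (in_basis n w x) :: ennreal) \<in> borel_measurable (Leb n)"
      by (rule measurable_compose[OF measurable_in_basis borel_measurable_indicator[OF D]])
    then have m: "(\<lambda>x. indicator ?D (in_basis n w x) :: ennreal) \<in> borel_measurable (PiM (insert p {..<p}) (\<lambda>_. lborel))"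
      unfolding n' .
    have "(\<integral>\<^sup>+x. indicator ?D (in_basis n w x) \<partial>PiM (insert p {..<p}) (\<lambda>_. lborel))
        = (\<integral>\<^sup>+c. \<integral>\<^sup>+s. indicator ?D (in_basis n w (c(p := s))) \<partial>lborel \<partial>Leb p)"
      by (rule lborel_prod.product_nn_integral_insert[OF finite_lessThan _ m]) simp
    then show ?thesis unfolding n'[symmetric] .
  qed
  also have "\<dots> \<le> (\<integral>\<^sup>+c. ennreal t * indicator (coords p C) c \<partial>Leb p)"
  proof (rule nn_integral_mono)
    fix c assume c: "c \<in> space (Leb p)"
    define pt where "pt = (\<lambda>s i. (\<Sum>j<p. c j * u j i) + s * \<theta> i)"
    define I where "I = {s. pt s \<in> K}"
    have ext: "zero_ext n (in_basis n w (c(p := s))) = pt s" for s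
    proof
      fix i
      show "zero_ext n (in_basis n w (c(p := s))) i = pt s i"
      proof (cases "i < n")
        case True
        have "(\<Sum>j<p. (c(p := s)) j * w j i) = (\<Sum>j<p. c j * u j i)"
          by (intro sum.cong) (auto simp: w_def)
        then have "(\<Sum>j<n. (c(p := s)) j * w j i) = pt s i"
          unfolding np by (simp add: pt_def) (simp add: w_def)
        then show ?thesis using True by (simp add: zero_ext_def in_basis_def)
      next
        case False
        then show ?thesis by (simp add: zero_ext_def pt_def u0 \<theta>0)
      qed
    qed
    have sp: "in_basis n w x \<in> space (Leb n)" for x
      by (simp add: space_Leb in_basis_def)
    have "(\<lambda>i. pt s i - t * \<theta> i) = pt (s - t)" for s by (simp add: pt_def fun_eq_iff algebra_simps)
    then have D_iff: "in_basis n w (c(p := s)) \<in> ?D \<longleftrightarrow> s \<in> {s \<in> I. s - t \<notin> I}" for s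
      by (simp add: coords_def sp ext I_def V_def) blast
    have D_ind: "indicator ?D (in_basis n w (c(p := s))) = (indicator {s \<in> I. s - t \<notin> I} s :: ennreal)" for s
      using D_iff[of s] by (simp only: indicator_def)
    show "(\<integral>\<^sup>+s. indicator ?D (in_basis n w (c(p := s))) \<partial>lborel) \<le> ennreal t * indicator (coords p C) c"
    proof (cases "I = {}")
      case True
      then show ?thesis unfolding D_ind by simp
    next
      case False
      then obtain s where s: "pt s \<in> K" by (auto simp: I_def)
      have "zero_ext p c \<in> C"
      proof -
        have d: "dot n (pt s) (u k) = c k" if "k < p" for k
        proof -
          have "dot n (pt s) (u k) = (\<Sum>j<p. c j * dot n (u j) (u k)) + s * dot n \<theta> (u k)"
            unfolding pt_def dot_def distrib_right sum.distrib sum_distrib_right sum_distrib_left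
            by (subst sum.swap) (simp add: mult.assoc)
          also have "\<dots> = (\<Sum>j<p. c j * (if j = k then 1 else 0)) + s * 0"
            using uu \<theta>u that by (intro arg_cong2[where f="(+)"] sum.cong) auto
          also have "\<dots> = c k" using that by (simp add: if_distrib cong: if_cong)
          finally show ?thesis .
        qed
        have "zero_ext p c = ?g (pt s)" by (auto simp: zero_ext_def d)
        then show ?thesis unfolding C_eq using s by blast
      qed
      then have "c \<in> coords p C" using c by (simp add: coords_def)
      moreover have "(\<integral>\<^sup>+s. indicator ?D (in_basis n w (c(p := s))) \<partial>lborel) \<le> ennreal t"
      proof -
        have conv: "y \<in> I" if "x \<in> I" "z \<in> I" "x \<le> y" "y \<le> z" for x y z
        proof (cases "x = z")
          case False
          define a where "a = (z - y) / (z - x)"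
          have "a * (z - x) = z - y" using False by (simp add: a_def)
          then have "a * x + (1 - a) * z = y" by (simp add: algebra_simps)
          moreover have "0 \<le> a" "a \<le> 1" using that False by (simp_all add: a_def)
          ultimately have a: "0 \<le> a" "a \<le> 1" "a * x + (1 - a) * z = y" by auto
          have "(\<lambda>i. a * pt x i + (1 - a) * pt z i) = pt (a * x + (1 - a) * z)"
            by (simp add: pt_def fun_eq_iff algebra_simps)
          moreover have "(\<lambda>i. a * pt x i + (1 - a) * pt z i) \<in> K"
            using K(2) that a unfolding convex_set_def I_def by auto
          ultimately show ?thesis using a by (simp add: I_def)
        qed (use that in auto)
        have "continuous_on UNIV pt"
          unfolding pt_def by (intro continuous_on_coordinatewise_then_product continuous_intros)
        then have [measurable]: "I \<in> sets borel"
          using closed_vimage[OF \<open>closed K\<close>, of pt] by (auto simp: I_def vimage_def)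
        have [measurable]: "{s \<in> I. s - t \<notin> I} \<in> sets borel" by measurable
        have "(\<integral>\<^sup>+s. indicator ?D (in_basis n w (c(p := s))) \<partial>lborel) = emeasure lborel {s \<in> I. s - t \<notin> I}"
          unfolding D_ind by simp
        also have "\<dots> \<le> ennreal t" using conv t by (rule emeasure_diff_translate_le)
        finally show ?thesis .
      qed
      ultimately show ?thesis by simp
    qed
  qed
  also have "\<dots> = ennreal t * emeasure (Leb p) (coords p C)"
    by (simp add: nn_integral_cmult)
  finally have "emeasure (Leb n) ?D \<le> ennreal t * emeasure (Leb p) (coords p C)" .
  moreover have fin: "emeasure (Leb p) (coords p C) < \<infinity>" "emeasure (Leb n) (coords n K) < \<infinity>"
    by (rule emeasure_coords_compact, fact)+
  ultimately have "measure (Leb n) ?D \<le> enn2real (ennreal t * emeasure (Leb p) (coords p C))"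
    unfolding measure_def by (intro enn2real_mono) (auto simp: ennreal_mult_less_top)
  also have "\<dots> = t * measure (Leb p) (coords p C)"
    using t by (simp add: enn2real_mult measure_def)
  finally have "measure (Leb n) ?D \<le> t * measure (Leb p) (coords p C)" .
  moreover have "measure (Leb n) ?D = measure (Leb n) (coords n K) - measure (Leb n) (coords n V)"
  proof (rule measure_Diff)
    show "emeasure (Leb n) (coords n K) \<noteq> \<infinity>" using fin by simp
    show "coords n K \<in> sets (Leb n)" "coords n V \<in> sets (Leb n)" using meas by (auto intro: sets_coords)
    show "coords n V \<subseteq> coords n K" by (auto simp: coords_def V_def)
  qed
  moreover have "vol n K = measure (Leb n) (coords n K)" "vol n V = measure (Leb n) (coords n V)"
    "vol p C = measure (Leb p) (coords p C)"
    using K(3) by (auto intro!: vol_eq_measure_coords simp: V_def C_def)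
  ultimately show ?thesis unfolding hv V_def[symmetric] by simp
qed

section \<open>Bodies cut out by slabs\<close>

definition slab_body :: "nat \<Rightarrow> nat \<Rightarrow> (nat \<Rightarrow> nat \<Rightarrow> real) \<Rightarrow> (nat \<Rightarrow> real) \<Rightarrow> (nat \<Rightarrow> real) set"
  where "slab_body n m u h = {x \<in> topspace (Euclidean_space n). \<forall>i<m. \<bar>dot n (u i) x\<bar> \<le> h i}"

lemma coords_slab_body:
  "coords n (slab_body n m u h) = {x \<in> space (Leb n). \<forall>i<m. \<bar>dot n (u i) x\<bar> \<le> h i}"
proof -
  have "dot n (u i) (zero_ext n x) = dot n (u i) x" for i x
    by (simp add: dot_def zero_ext_def)
  then show ?thesis by (auto simp: coords_def slab_body_def topspace_Euclidean_space zero_ext_def)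
qed

lemma closed_slab_body: "closed (slab_body n m u h)"
proof -
  have "slab_body n m u h = (\<Inter>i\<in>{n..}. {x. x i = 0}) \<inter> (\<Inter>i\<in>{..<m}. {x. \<bar>dot n (u i) x\<bar> \<le> h i})"
    by (auto simp: slab_body_def topspace_Euclidean_space)
  moreover have "closed {x :: nat \<Rightarrow> real. x i = 0}" for i
    by (intro closed_Collect_eq continuous_intros)
  moreover have "closed {x. \<bar>dot n (u i) x\<bar> \<le> h i}" for i
    unfolding dot_def by (intro closed_Collect_le continuous_intros)
  ultimately show ?thesis by (simp only:) (intro closed_Int closed_INT ballI)
qed

lemma sets_coords_slab_body [measurable]: "coords n (slab_body n m u h) \<in> sets (Leb n)"
  by (intro sets_coords borel_closed closed_slab_body)

lemma vol_slab_body: "vol n (slab_body n m u h) = measure (Leb n) (coords n (slab_body n m u h))"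
  by (intro vol_eq_measure_coords) (auto simp: slab_body_def)

text \<open>
  The sum of the half-widths bounds the seminorm on the body, and the seminorm dominates the norm. The
  bound depends on \<open>h\<close> through its sum alone, which makes the volumes of all competitors in the
  extremal problem bounded.
\<close>

lemma slab_body_coordinate_bound:
  assumes "a > 0" "\<And>x. a * L2_set x {..<n} \<le> slab_sum n m u x" "x \<in> slab_body n m u h"
  shows "\<bar>x i\<bar> \<le> (\<Sum>i<m. h i) / a"
proof -
  have "a * L2_set x {..<n} \<le> (\<Sum>i<m. h i)"
    using assms(3) by (intro order_trans[OF assms(2)]) (auto simp: slab_sum_def slab_body_def intro!: sum_mono)
  then have l: "L2_set x {..<n} \<le> (\<Sum>i<m. h i) / a" using assms(1) by (simp add: field_simps)
  moreover from l have "0 \<le> (\<Sum>i<m. h i) / a" using order_trans[OF L2_set_nonneg] by blast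
  ultimately show "\<bar>x i\<bar> \<le> (\<Sum>i<m. h i) / a"
    using coordinate_le_L2_set[of i n x] assms(3)
    by (cases "i < n") (auto simp: slab_body_def topspace_Euclidean_space)
qed

lemma compact_slab_body:
  assumes "a > 0" "\<And>x. a * L2_set x {..<n} \<le> slab_sum n m u x"
  shows "compact (slab_body n m u h)"
proof -
  let ?R = "(\<Sum>i<m. h i) / a"
  have "compactin (product_topology (\<lambda>i::nat. euclideanreal) UNIV) (PiE UNIV (\<lambda>_. {- ?R..?R}))"
    by (simp add: compactin_PiE)
  then have "compact (PiE (UNIV :: nat set) (\<lambda>_. {- ?R..?R}))"
    by (simp add: euclidean_product_topology)
  moreover have "slab_body n m u h \<subseteq> PiE UNIV (\<lambda>_. {- ?R..?R})"
    using slab_body_coordinate_bound[OF assms, of _ h] by (auto simp: abs_le_iff minus_le_iff)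
  ultimately show ?thesis
    using closed_slab_body compact_Int_closed by (metis inf.absorb2)
qed

lemma convex_set_slab_body: "convex_set (slab_body n m u h)"
  unfolding convex_set_def
  proof (intro ballI allI impI)
  fix x y and s t :: real
  assume x: "x \<in> slab_body n m u h" and y: "y \<in> slab_body n m u h"
    and st: "0 \<le> s" "0 \<le> t" "s + t = 1"
  have "\<bar>dot n (u i) (\<lambda>i. s * x i + t * y i)\<bar> \<le> h i" if "i < m" for i
  proof -
    have "\<bar>dot n (u i) (\<lambda>i. s * x i + t * y i)\<bar> \<le> s * \<bar>dot n (u i) x\<bar> + t * \<bar>dot n (u i) y\<bar>"
      unfolding dot_add_right dot_scale_right using st
      by (intro order_trans[OF abs_triangle_ineq]) (simp add: abs_mult)
    also have "\<dots> \<le> s * h i + t * h i"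
      using x y st that by (intro add_mono mult_left_mono) (auto simp: slab_body_def)
    also have "\<dots> = h i" using st by (simp flip: distrib_right)
    finally show ?thesis .
  qed
  then show "(\<lambda>i. s * x i + t * y i) \<in> slab_body n m u h"
    using x y by (auto simp: slab_body_def topspace_Euclidean_space)
qed

lemma convex_body_slab_body:
  assumes "a > 0" "\<And>x. a * L2_set x {..<n} \<le> slab_sum n m u x" and h: "\<And>i. i < m \<Longrightarrow> h i > 0"
  shows "convex_body n (slab_body n m u h)"
  unfolding convex_body_def
proof (intro conjI)
  show "compactin (Euclidean_space n) (slab_body n m u h)"
    unfolding Euclidean_space_def compactin_subtopology euclidean_product_topology
    using compact_slab_body[OF assms(1,2)] by (auto simp: slab_body_def topspace_Euclidean_space)
  show "convex_set (slab_body n m u h)" by (rule convex_set_slab_body)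
  let ?U = "\<Inter>i\<in>{..<m}. {x. \<bar>dot n (u i) x\<bar> < h i}"
  let ?E = "{x :: nat \<Rightarrow> real. \<forall>i\<ge>n. x i = 0}"
  have "open {x. \<bar>dot n (u i) x\<bar> < h i}" for i
    unfolding dot_def by (intro open_Collect_less continuous_intros)
  then have "open ?U" by auto
  then have "openin (Euclidean_space n) (?E \<inter> ?U)"
    unfolding Euclidean_space_def euclidean_product_topology by (simp add: openin_open_Int)
  moreover have "?E \<inter> ?U \<subseteq> slab_body n m u h"
    by (auto simp: slab_body_def topspace_Euclidean_space intro: less_imp_le)
  ultimately have "?E \<inter> ?U \<subseteq> Euclidean_space n interior_of slab_body n m u h"
    by (rule interior_of_maximal[rotated])
  moreover have "(\<lambda>_. 0) \<in> ?E \<inter> ?U" using h by (auto simp: dot_def)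
  ultimately have "(\<lambda>_. 0) \<in> Euclidean_space n interior_of slab_body n m u h" by (rule subsetD)
  then show "Euclidean_space n interior_of slab_body n m u h \<noteq> {}" by (metis empty_iff)
qed

lemma symmetric_set_slab_body: "symmetric_set (slab_body n m u h)"
proof -
  have "(\<lambda>i. - x i) \<in> slab_body n m u h" if "x \<in> slab_body n m u h" for x
    using that dot_scale_right[of n _ "-1" x] by (simp add: slab_body_def topspace_Euclidean_space)
  then have "x \<in> (\<lambda>x i. - x i) ` slab_body n m u h" if "x \<in> slab_body n m u h" for x
    using that by (intro image_eqI[of _ _ "\<lambda>i. - x i"]) auto
  then show ?thesis
    using \<open>\<And>x. x \<in> slab_body n m u h \<Longrightarrow> (\<lambda>i. - x i) \<in> slab_body n m u h\<close>
    unfolding symmetric_set_def by blast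
qed

lemma emeasure_Leb_translate:
  assumes A: "A \<in> sets (Leb n)"
  shows "emeasure (Leb n) {x \<in> space (Leb n). (\<lambda>i\<in>{..<n}. x i + v i) \<in> A} = emeasure (Leb n) A"
proof -
  have T: "(\<lambda>x. \<lambda>i\<in>{..<n}. x i + v i) \<in> Leb n \<rightarrow>\<^sub>M Leb n" by measurable
  have "{x \<in> space (Leb n). (\<lambda>i\<in>{..<n}. x i + v i) \<in> A} \<in> sets (Leb n)"
    using measurable_sets[OF T A] by (simp add: vimage_def Int_def conj_commute)
  then have "emeasure (Leb n) {x \<in> space (Leb n). (\<lambda>i\<in>{..<n}. x i + v i) \<in> A}
      = (\<integral>\<^sup>+x. indicator {x \<in> space (Leb n). (\<lambda>i\<in>{..<n}. x i + v i) \<in> A} x \<partial>Leb n)"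
    by simp
  also have "\<dots> = (\<integral>\<^sup>+x. indicator A (\<lambda>i\<in>{..<n}. x i + v i) \<partial>Leb n)"
    by (intro nn_integral_cong) (simp add: indicator_def)
  also have "\<dots> = emeasure (Leb n) A"
    using A by (subst nn_integral_Leb_translate) auto
  finally show ?thesis .
qed

lemma vol_slab_body_scale:
  assumes s: "s > 0"
  shows "vol n (slab_body n m u (\<lambda>i. s * h i)) = s ^ n * vol n (slab_body n m u h)"
proof -
  let ?A = "coords n (slab_body n m u (\<lambda>i. s * h i))" and ?B = "coords n (slab_body n m u h)"
  have "emeasure (Leb n) ?A = (\<integral>\<^sup>+x. indicator ?A x \<partial>Leb n)" by simp
  also have "\<dots> = ennreal (s ^ n) * (\<integral>\<^sup>+x. indicator ?A (\<lambda>i\<in>{..<n}. 0 + s * x i) \<partial>Leb n)"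
    by (rule nn_integral_Leb_affine[OF _ s]) measurable
  also have "(\<integral>\<^sup>+x. indicator ?A (\<lambda>i\<in>{..<n}. 0 + s * x i) \<partial>Leb n) = (\<integral>\<^sup>+x. indicator ?B x \<partial>Leb n)"
  proof (rule nn_integral_cong)
    fix x assume x: "x \<in> space (Leb n)"
    have "dot n (u i) (\<lambda>i\<in>{..<n}. 0 + s * x i) = s * dot n (u i) x" for i
      by (simp add: dot_def sum_distrib_left algebra_simps)
    then have "(\<lambda>i\<in>{..<n}. 0 + s * x i) \<in> ?A \<longleftrightarrow> x \<in> ?B"
      using x s by (simp add: coords_slab_body abs_mult) (simp add: space_Leb)
    then show "(indicator ?A (\<lambda>i\<in>{..<n}. 0 + s * x i) :: ennreal) = indicator ?B x"
      by (simp only: indicator_def)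
  qed
  finally have "emeasure (Leb n) ?A = ennreal (s ^ n) * emeasure (Leb n) ?B" by simp
  then show ?thesis using s by (simp add: vol_slab_body measure_def enn2real_mult)
qed

lemma emeasure_coords_slab_body_finite:
  assumes "a > 0" "\<And>x. a * L2_set x {..<n} \<le> slab_sum n m u x"
  shows "emeasure (Leb n) (coords n (slab_body n m u h)) < \<infinity>"
  by (intro emeasure_coords_compact compact_slab_body[OF assms])

lemma vol_slab_body_mono:
  assumes "a > 0" "\<And>x. a * L2_set x {..<n} \<le> slab_sum n m u x" and h: "\<And>i. i < m \<Longrightarrow> h i \<le> h' i"
  shows "vol n (slab_body n m u h) \<le> vol n (slab_body n m u h')"
  unfolding vol_slab_body measure_def
proof (intro enn2real_mono emeasure_mono)
  show "coords n (slab_body n m u h) \<subseteq> coords n (slab_body n m u h')"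
    using h by (force simp: coords_slab_body)
  show "emeasure (Leb n) (coords n (slab_body n m u h')) < top"
    using emeasure_coords_slab_body_finite[OF assms(1,2)] by simp
qed measurable

lemma vol_slab_body_le:
  assumes a: "a > 0" "\<And>x. a * L2_set x {..<n} \<le> slab_sum n m u x" and h: "(\<Sum>i<m. h i) \<le> R * a" and R: "R \<ge> 0"
  shows "vol n (slab_body n m u h) \<le> (2 * R) ^ n"
proof -
  have "coords n (slab_body n m u h) \<subseteq> PiE {..<n} (\<lambda>_. {- R..R})"
  proof
    fix x assume x: "x \<in> coords n (slab_body n m u h)"
    have "\<bar>x i\<bar> \<le> R" if "i < n" for i
    proof -
      have "\<bar>zero_ext n x i\<bar> \<le> (\<Sum>i<m. h i) / a"
        using x by (intro slab_body_coordinate_bound[OF a]) (auto simp: coords_def)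
      also have "\<dots> \<le> R" using h a(1) by (simp add: pos_divide_le_eq)
      finally show ?thesis using that by (simp add: zero_ext_def)
    qed
    then show "x \<in> PiE {..<n} (\<lambda>_. {- R..R})"
      using x by (auto simp: coords_def space_Leb PiE_def Pi_def abs_le_iff minus_le_iff)
  qed
  then have "emeasure (Leb n) (coords n (slab_body n m u h)) \<le> emeasure (Leb n) (PiE {..<n} (\<lambda>_. {- R..R}))"
    by (intro emeasure_mono sets_Leb_box)
  also have "\<dots> = ennreal ((2 * R) ^ n)" using R by (subst emeasure_Leb_box) auto
  finally show ?thesis unfolding vol_slab_body measure_def using R by (intro enn2real_leI) auto
qed

text \<open>
  If \<open>x\<close> and \<open>x - t\<theta>\<close> both lie in a slab of half-width \<open>H\<close>, then their midpoint lies in the slab whose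
  half-width is smaller by half the distance of the two points across the slab.
\<close>

lemma vol_overlap_slab_body_le:
  assumes a: "a > 0" "\<And>x. a * L2_set x {..<n} \<le> slab_sum n m u x" and t: "t \<ge> 0"
  shows "vol n {x \<in> slab_body n m u h. (\<lambda>i. x i - t * \<theta> i) \<in> slab_body n m u h}
    \<le> vol n (slab_body n m u (\<lambda>i. h i - t / 2 * \<bar>dot n (u i) \<theta>\<bar>))" (is "vol n ?O \<le> vol n ?K'")
proof -
  define v where "v = (\<lambda>i. - (t / 2) * \<theta> i)"
  have "coords n ?O \<subseteq> {x \<in> space (Leb n). (\<lambda>i\<in>{..<n}. x i + v i) \<in> coords n ?K'}"
  proof
    fix x assume "x \<in> coords n ?O"
    then have sp: "x \<in> space (Leb n)" and x: "zero_ext n x \<in> slab_body n m u h"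
      and x': "(\<lambda>i. zero_ext n x i - t * \<theta> i) \<in> slab_body n m u h"
      by (auto simp: coords_def)
    have "\<bar>dot n (u i) (\<lambda>i\<in>{..<n}. x i + v i)\<bar> \<le> h i - t / 2 * \<bar>dot n (u i) \<theta>\<bar>" if i: "i < m" for i
    proof -
      have d: "dot n (u i) (zero_ext n x) = dot n (u i) x" by (simp add: dot_def zero_ext_def)
      have "dot n (u i) (\<lambda>i. zero_ext n x i - t * \<theta> i) = dot n (u i) x - t * dot n (u i) \<theta>"
        using dot_add_right[of n "u i" "zero_ext n x" "\<lambda>i. (- t) * \<theta> i"] dot_scale_right[of n "u i" "- t" \<theta>] d
        by simp
      then have 1: "\<bar>dot n (u i) x\<bar> \<le> h i" "\<bar>dot n (u i) x - t * dot n (u i) \<theta>\<bar> \<le> h i"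
        using x x' i d by (auto simp: slab_body_def)
      have "dot n (u i) (\<lambda>i\<in>{..<n}. x i + v i) = dot n (u i) (\<lambda>i. x i + v i)"
        by (simp add: dot_def)
      also have "\<dots> = dot n (u i) x - t / 2 * dot n (u i) \<theta>"
        unfolding dot_add_right v_def dot_scale_right by simp
      finally have 2: "dot n (u i) (\<lambda>i\<in>{..<n}. x i + v i) = dot n (u i) x - t / 2 * dot n (u i) \<theta>" .
      \<comment> \<open>With \<open>p = \<langle>u\<^sub>i, x\<rangle>\<close> and \<open>2 * q\<close> the displacement across the slab.\<close>
      have "\<bar>p - q\<bar> \<le> H - \<bar>q\<bar>" if "\<bar>p\<bar> \<le> H" "\<bar>p - 2 * q\<bar> \<le> H" for p q H :: real
        using that by linarith
      from this[of "dot n (u i) x" "h i" "t / 2 * dot n (u i) \<theta>"] show ?thesis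
        using 1 2 t by (simp add: abs_mult)
    qed
    then show "x \<in> {x \<in> space (Leb n). (\<lambda>i\<in>{..<n}. x i + v i) \<in> coords n ?K'}"
      using sp by (simp add: coords_slab_body space_Leb)
  qed
  moreover have "{x \<in> space (Leb n). (\<lambda>i\<in>{..<n}. x i + v i) \<in> coords n ?K'} \<in> sets (Leb n)"
  proof -
    have T: "(\<lambda>x. \<lambda>i\<in>{..<n}. x i + v i) \<in> Leb n \<rightarrow>\<^sub>M Leb n" by measurable
    show ?thesis using measurable_sets[OF T sets_coords_slab_body[of n m u "\<lambda>i. h i - t / 2 * \<bar>dot n (u i) \<theta>\<bar>"]]
      by (simp add: vimage_def Int_def conj_commute)
  qed
  ultimately have "emeasure (Leb n) (coords n ?O) \<le> emeasure (Leb n) {x \<in> space (Leb n). (\<lambda>i\<in>{..<n}. x i + v i) \<in> coords n ?K'}"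
    by (rule emeasure_mono)
  also have "\<dots> = emeasure (Leb n) (coords n ?K')"
    by (rule emeasure_Leb_translate) (rule sets_coords_slab_body)
  finally have "emeasure (Leb n) (coords n ?O) \<le> emeasure (Leb n) (coords n ?K')" .
  then have "measure (Leb n) (coords n ?O) \<le> measure (Leb n) (coords n ?K')"
    unfolding measure_def using emeasure_coords_slab_body_finite[OF a] by (intro enn2real_mono) auto
  moreover have "vol n ?O = measure (Leb n) (coords n ?O)"
    by (intro vol_eq_measure_coords) (auto simp: slab_body_def)
  ultimately show ?thesis by (simp add: vol_slab_body)
qed

section \<open>Slab bodies of nearly maximal volume\<close>

text \<open>
  Pigeonhole principle for convex cells, as in Siegel's lemma: two points of a cell have coordinates
  \<open>\<langle>u\<^sub>i, x\<rangle>\<close> with equal integer parts, so their difference lies in the unit slab body. The cube has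
  half-side \<open>1/\<surd>n\<close> because it then lies in the unit ball, where the upper bound limits the vectors of
  integer parts to an l1 ball of radius \<open>(B + 1) * m\<close>.
\<close>

lemma vol_unit_slab_body_ge:
  assumes n: "n \<ge> 1" and lower: "a > 0" "\<And>x. a * L2_set x {..<n} \<le> slab_sum n m u x"
    and upper: "\<And>x. slab_sum n m u x \<le> real B * real m * L2_set x {..<n}"
  shows "(2 / sqrt (real n)) ^ n \<le> (3 * 2 ^ (B + 1)) ^ m * vol n (slab_body n m u (\<lambda>_. 1))"
proof -
  let ?r = "1 / sqrt (real n)"
  let ?K = "coords n (slab_body n m u (\<lambda>_. 1))"
  define Q where "Q = PiE {..<n} (\<lambda>_. {- ?r..?r})"
  define Z where "Z = int_vectors m ((B + 1) * m)"
  define cell where "cell = (\<lambda>z. {x \<in> Q. \<forall>i<m. \<lfloor>dot n (u i) x\<rfloor> = z i})"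
  have Q [measurable]: "Q \<in> sets (Leb n)" unfolding Q_def by (rule sets_Leb_box)
  have Q_space: "Q \<subseteq> space (Leb n)" using Q by (rule sets.sets_into_space)
  have cell_sets: "cell z \<in> sets (Leb n)" for z
  proof -
    have "cell z = {x \<in> space (Leb n). x \<in> Q \<and> (\<forall>i<m. \<lfloor>dot n (u i) x\<rfloor> = z i)}"
      using Q_space by (auto simp: cell_def)
    moreover have "(\<lambda>x. dot n (u i) x) \<in> borel_measurable (Leb n)" for i
      using measurable_dot_Leb[of n "u i"] by (simp add: dot_commute[of n "u i"])
    ultimately show ?thesis by simp
  qed
  have cover: "Q \<subseteq> (\<Union>z\<in>Z. cell z)"
  proof
    fix x assume x: "x \<in> Q"
    define z where "z = (\<lambda>i\<in>{..<m}. \<lfloor>dot n (u i) x\<rfloor>)"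
    have "L2_set x {..<n} \<le> L2_set (\<lambda>_. ?r) {..<n}"
    proof (rule L2_set_mono_abs)
      fix j assume "j < n"
      then have "x j \<in> {- ?r..?r}" using x unfolding Q_def by (intro PiE_mem[of x]) auto
      then show "\<bar>x j\<bar> \<le> \<bar>?r\<bar>" by auto
    qed
    also have "\<dots> = 1" using n by (simp add: L2_set_constant)
    finally have x1: "L2_set x {..<n} \<le> 1" .
    have "real_of_int (\<Sum>i<m. \<bar>z i\<bar>) \<le> (\<Sum>i<m. \<bar>dot n (u i) x\<bar> + 1)"
      unfolding of_int_sum by (intro sum_mono) (simp add: z_def, linarith)
    also have "\<dots> = slab_sum n m u x + real m" by (simp add: slab_sum_def sum.distrib)
    also have "\<dots> \<le> real B * real m * 1 + real m"
      using x1 by (intro add_right_mono order_trans[OF upper] mult_left_mono) auto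
    also have "\<dots> = real_of_int (int ((B + 1) * m))" by (simp add: algebra_simps)
    finally have "(\<Sum>i<m. \<bar>z i\<bar>) \<le> int ((B + 1) * m)" by (simp only: of_int_le_iff)
    then have "z \<in> Z" by (simp add: Z_def int_vectors_def z_def)
    moreover have "x \<in> cell z" using x by (simp add: cell_def z_def)
    ultimately show "x \<in> (\<Union>z\<in>Z. cell z)" by blast
  qed
  have cell_le: "emeasure (Leb n) (cell z) \<le> emeasure (Leb n) ?K" for z
  proof (cases "cell z = {}")
    case False
    then obtain y where y: "y \<in> cell z" by auto
    have "cell z \<subseteq> {x \<in> space (Leb n). (\<lambda>i\<in>{..<n}. x i + (- y i)) \<in> ?K}" (is "_ \<subseteq> ?T")
    proof
      fix x assume x: "x \<in> cell z"
      have "\<bar>dot n (u i) (\<lambda>i\<in>{..<n}. x i + (- y i))\<bar> \<le> 1" if "i < m" for i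
      proof -
        have "dot n (u i) (\<lambda>i\<in>{..<n}. x i + (- y i)) = dot n (u i) (\<lambda>i. x i + (- 1) * y i)"
          by (simp add: dot_def)
        also have "\<dots> = dot n (u i) x - dot n (u i) y"
          unfolding dot_add_right dot_scale_right by simp
        finally have e: "dot n (u i) (\<lambda>i\<in>{..<n}. x i + (- y i)) = dot n (u i) x - dot n (u i) y" .
        have "\<lfloor>dot n (u i) x\<rfloor> = \<lfloor>dot n (u i) y\<rfloor>" using x y that by (simp add: cell_def)
        then have "\<bar>dot n (u i) x - dot n (u i) y\<bar> \<le> 1" by linarith
        then show ?thesis unfolding e .
      qed
      moreover have "x \<in> space (Leb n)" using x Q_space by (auto simp: cell_def)
      ultimately show "x \<in> ?T" by (simp add: coords_slab_body space_Leb)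
    qed
    moreover have "?T \<in> sets (Leb n)"
    proof -
      have T: "(\<lambda>x. \<lambda>i\<in>{..<n}. x i + (- y i)) \<in> Leb n \<rightarrow>\<^sub>M Leb n" by measurable
      show ?thesis using measurable_sets[OF T sets_coords_slab_body[of n m u "\<lambda>_. 1"]]
        by (simp add: vimage_def Int_def conj_commute)
    qed
    ultimately have "emeasure (Leb n) (cell z) \<le> emeasure (Leb n) ?T" by (rule emeasure_mono)
    also have "\<dots> = emeasure (Leb n) ?K" by (rule emeasure_Leb_translate) (rule sets_coords_slab_body)
    finally show ?thesis .
  qed simp
  have finZ: "finite Z" unfolding Z_def by (rule int_vectors_bound)
  have "emeasure (Leb n) Q \<le> emeasure (Leb n) (\<Union>z\<in>Z. cell z)"
    using cover cell_sets finZ by (intro emeasure_mono sets.finite_UN) auto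
  also have "\<dots> \<le> (\<Sum>z\<in>Z. emeasure (Leb n) (cell z))"
    using cell_sets finZ by (intro emeasure_subadditive_finite) auto
  also have "\<dots> \<le> of_nat (card Z) * emeasure (Leb n) ?K"
    using cell_le by (rule sum_bounded_above)
  finally have "emeasure (Leb n) Q \<le> of_nat (card Z) * emeasure (Leb n) ?K" .
  moreover have "emeasure (Leb n) Q = ennreal ((2 / sqrt (real n)) ^ n)"
    unfolding Q_def by (subst emeasure_Leb_box) auto
  moreover have "emeasure (Leb n) ?K = ennreal (vol n (slab_body n m u (\<lambda>_. 1)))"
    unfolding vol_slab_body using emeasure_coords_slab_body_finite[OF lower]
    by (intro emeasure_eq_ennreal_measure) (simp add: less_top)
  ultimately have "(2 / sqrt (real n)) ^ n \<le> real (card Z) * vol n (slab_body n m u (\<lambda>_. 1))"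
    by (simp add: vol_def measure_nonneg ennreal_of_nat_eq_real_of_nat flip: ennreal_mult)
  also have "\<dots> \<le> (3 ^ m * 2 ^ ((B + 1) * m)) * vol n (slab_body n m u (\<lambda>_. 1))"
    using int_vectors_bound(2)[of m "(B + 1) * m"]
    by (intro mult_right_mono) (auto simp: Z_def vol_def)
  also have "(3::real) ^ m * 2 ^ ((B + 1) * m) = (3 * 2 ^ (B + 1)) ^ m"
    unfolding power_mult power_mult_distrib ..
  finally show ?thesis .
qed

text \<open>
  A near-maximiser \<open>g\<close> exists because the volumes are bounded. Its entries are nonnegative, as its body is not empty. Replacing \<open>g\<close> by \<open>(g + 1/n) / (1 + 1/n)\<close> makes them
  positive and costs a factor of at most \<open>(1 + 1/n) ^ n \<le> exp 1\<close> in volume.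
\<close>

lemma exists_near_maximal_slab_body:
  assumes a: "a > 0" "\<And>x. a * L2_set x {..<n} \<le> slab_sum n m u x"
    and n: "n \<ge> 1" and m: "m \<ge> 1" and pos: "vol n (slab_body n m u (\<lambda>_. 1)) > 0"
  shows "\<exists>h. (\<forall>i<m. h i > 0) \<and> (\<Sum>i<m. h i) \<le> real m \<and> (\<forall>g. (\<Sum>i<m. g i) \<le> real m \<longrightarrow>
    vol n (slab_body n m u g) \<le> 2 * exp 1 * vol n (slab_body n m u h))"
proof -
  let ?V = "\<lambda>h. vol n (slab_body n m u h)"
  let ?H = "{h. (\<Sum>i<m. h i) \<le> real m}"
  define S where "S = (SUP h\<in>?H. ?V h)"
  have "?V h \<le> (2 * (real m / a)) ^ n" if "h \<in> ?H" for h
    using that a(1) by (intro vol_slab_body_le[OF a]) auto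
  then have bdd: "bdd_above (?V ` ?H)" by (auto intro!: bdd_aboveI2)
  have S: "?V h \<le> S" if "(\<Sum>i<m. h i) \<le> real m" for h
    unfolding S_def using that bdd by (intro cSUP_upper) auto
  have "S > 0" using S[of "\<lambda>_. 1"] pos by simp
  then have "S / 2 < (SUP h\<in>?H. ?V h)" by (simp add: S_def)
  moreover have "?H \<noteq> {}" by (auto intro!: exI[of _ "\<lambda>_. 0"])
  ultimately have "\<exists>g\<in>?H. S / 2 < ?V g" using less_cSUP_iff[OF _ bdd] by blast
  then obtain g where g: "(\<Sum>i<m. g i) \<le> real m" "S / 2 < ?V g" by auto
  have "?V g > 0" using g \<open>S > 0\<close> by linarith
  have g0: "g i \<ge> 0" if "i < m" for i
  proof (rule ccontr)
    assume "\<not> g i \<ge> 0"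
    then have "slab_body n m u g = {}" using that by (force simp: slab_body_def)
    then show False using \<open>?V g > 0\<close> by (simp add: vol_def)
  qed
  define s where "s = 1 + 1 / real n"
  have s: "s > 0" by (simp add: s_def add_pos_nonneg)
  define h where "h = (\<lambda>i. (g i + 1 / real n) / s)"
  have h_pos: "h i > 0" if "i < m" for i
    using g0[OF that] s n by (simp add: h_def add_nonneg_pos)
  have "(\<Sum>i<m. h i) = ((\<Sum>i<m. g i) + real m / real n) / s"
    by (simp add: h_def sum.distrib flip: sum_divide_distrib)
  also have "\<dots> \<le> (real m + real m / real n) / s"
    using g(1) s by (intro divide_right_mono) auto
  also have "\<dots> = real m" using s by (simp add: s_def field_simps)
  finally have h_sum: "(\<Sum>i<m. h i) \<le> real m" .
  have "?V g \<le> ?V (\<lambda>i. s * h i)"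
    using s by (intro vol_slab_body_mono[OF a]) (simp add: h_def)
  also have "\<dots> = s ^ n * ?V h" using s by (rule vol_slab_body_scale)
  also have "\<dots> \<le> exp 1 * ?V h"
  proof (rule mult_right_mono)
    have "s ^ n \<le> exp (1 / real n) ^ n"
      unfolding s_def using exp_ge_add_one_self[of "1 / real n"] by (intro power_mono) auto
    also have "\<dots> = exp 1" using n by (simp flip: exp_of_nat_mult)
    finally show "s ^ n \<le> exp 1" .
  qed (simp add: vol_def)
  finally have V: "?V g \<le> exp 1 * ?V h" .
  have "?V f \<le> 2 * exp 1 * ?V h" if "(\<Sum>i<m. f i) \<le> real m" for f
    using S[OF that] g(2) V by simp
  with h_pos h_sum show ?thesis by (intro exI[of _ h]) simp
qed

text \<open>
  Translation by \<open>t = 6 / (c * n)\<close> decreases the sum of the half-widths from at most \<open>m\<close> to at most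
  \<open>m * (1 - 3/n) \<le> m * s\<close> with \<open>s = exp (-3/n)\<close>. Rescaling by \<open>s\<close> and near-maximality bound the overlap
  by \<open>2 * exp 1 * exp (-3)\<close> times the volume, which is less than half of it. Using \<open>s\<close> in place of
  \<open>1 - 3/n\<close> keeps the scaling factor positive in small dimensions.
\<close>

lemma near_maximal_slab_body_shadow:
  assumes n: "n \<ge> 1" and m: "m \<ge> 1" and c: "c > 0"
    and lower: "\<And>x. c * real m * L2_set x {..<n} \<le> slab_sum n m u x"
    and h_sum: "(\<Sum>i<m. h i) \<le> real m"
    and max: "\<And>g. (\<Sum>i<m. g i) \<le> real m \<Longrightarrow>
      vol n (slab_body n m u g) \<le> 2 * exp 1 * vol n (slab_body n m u h)"
    and \<theta>: "unit_vector n \<theta>"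
  shows "c * real n / 12 * vol n (slab_body n m u h)
    \<le> hyperplane_vol n \<theta> (proj n \<theta> ` slab_body n m u h)"
proof -
  let ?V = "\<lambda>h. vol n (slab_body n m u h)"
  have a: "c * real m > 0" using c m by simp
  define t where "t = 6 / (c * real n)"
  have t: "t > 0" using c n by (simp add: t_def)
  define s where "s = exp (- 3 / real n)"
  have s: "s > 0" by (simp add: s_def)
  define g where "g = (\<lambda>i. h i - t / 2 * \<bar>dot n (u i) \<theta>\<bar>)"
  have \<theta>1: "L2_set \<theta> {..<n} = 1"
    using \<theta> by (simp add: unit_vector_def L2_set_def dot_def power2_eq_square)
  have "(\<Sum>i<m. g i) = (\<Sum>i<m. h i) - t / 2 * slab_sum n m u \<theta>"
    by (simp add: g_def slab_sum_def sum_subtractf sum_distrib_left)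
  also have "\<dots> \<le> real m - t / 2 * (c * real m)"
    using lower[of \<theta>] \<theta>1 h_sum t by (intro diff_mono mult_left_mono) auto
  also have "\<dots> = real m * (1 + - 3 / real n)"
    using c n by (simp add: t_def field_simps)
  also have "\<dots> \<le> real m * s"
    unfolding s_def by (intro mult_left_mono exp_ge_add_one_self) auto
  finally have "(\<Sum>i<m. g i) / s \<le> real m" using s by (simp add: pos_divide_le_eq)
  then have g': "(\<Sum>i<m. g i / s) \<le> real m" by (simp add: sum_divide_distrib)
  have "?V g = s ^ n * ?V (\<lambda>i. g i / s)"
    using vol_slab_body_scale[OF s, of n m u "\<lambda>i. g i / s"] s by simp
  also have "\<dots> \<le> s ^ n * (2 * exp 1 * ?V h)"
    using s by (intro mult_left_mono max[OF g']) auto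
  also have "s ^ n = exp (- 3)"
    unfolding s_def using n by (simp flip: exp_of_nat_mult)
  also have "exp (- 3) * (2 * exp 1 * ?V h) = 2 * exp (- 2) * ?V h"
    using exp_add[of "- 3 :: real" 1] by simp
  also have "\<dots> \<le> 1 / 2 * ?V h"
  proof (rule mult_right_mono)
    have "(2::real) ^ 2 \<le> exp 1 ^ 2" using exp_ge_add_one_self[of 1] by (intro power_mono) auto
    also have "\<dots> = exp (2::real)" using exp_of_nat_mult[of 2 "1::real"] by simp
    finally show "2 * exp (- 2) \<le> (1 / 2 :: real)" by (simp add: exp_minus field_simps)
  qed (simp add: vol_def)
  finally have g: "?V g \<le> 1 / 2 * ?V h" .
  have "compact (slab_body n m u h)" using a lower by (rule compact_slab_body)
  moreover have "convex_set (slab_body n m u h)" by (rule convex_set_slab_body)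
  ultimately have "?V h \<le> vol n {x \<in> slab_body n m u h. (\<lambda>i. x i - t * \<theta> i) \<in> slab_body n m u h}
      + t * hyperplane_vol n \<theta> (proj n \<theta> ` slab_body n m u h)"
    using t by (intro vol_le_overlap_plus_shadow[OF n \<theta>]) (auto simp: slab_body_def)
  also have "vol n {x \<in> slab_body n m u h. (\<lambda>i. x i - t * \<theta> i) \<in> slab_body n m u h} \<le> ?V g"
    unfolding g_def using t by (intro vol_overlap_slab_body_le[OF a lower]) auto
  also note g
  finally have "?V h / 2 \<le> t * hyperplane_vol n \<theta> (proj n \<theta> ` slab_body n m u h)" by simp
  then show ?thesis using c n by (simp add: t_def field_simps)
qed

text \<open>
  The body is nearly maximal for a spread system, so its shadows are at least \<open>c n |K| / 12\<close>. Writing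
  \<open>|K|\<close> as \<open>|K|\<^bsup>1/n\<^esup> |K|\<^bsup>(n-1)/n\<^esup>\<close> leaves the task of bounding \<open>|K|\<^bsup>1/n\<^esup>\<close> from below by a multiple of
  \<open>1/\<surd>n\<close>, which follows from the volume of the unit slab body.
\<close>

theorem theorem5:
  shows "\<exists>\<delta>::real. \<delta> > 0 \<and>
    (\<forall>n::nat. n \<ge> 1 \<longrightarrow>
      (\<exists>K :: (nat \<Rightarrow> real) set. convex_body n K \<and> symmetric_set K \<and>
        (\<forall>\<theta>. unit_vector n \<theta> \<longrightarrow>
          hyperplane_vol n \<theta> (proj n \<theta> ` K)
            \<ge> \<delta> * sqrt (real n) * vol n K powr ((real n - 1) / real n))))"
proof -
  obtain c k where c: "c > 0" and k: "k \<ge> 1" and system: "\<forall>n\<ge>1. \<exists>u. \<forall>x.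
      c * real (k * n) * L2_set x {..<n} \<le> slab_sum n (k * n) u x
      \<and> slab_sum n (k * n) u x \<le> 16 * real (k * n) * L2_set x {..<n}"
    using exists_spread_slab_system by metis
  define D :: real where "D = (3 * 2 ^ (16 + 1)) ^ k"
  have D: "D \<ge> 1" unfolding D_def by (rule one_le_power) simp
  define \<delta> where "\<delta> = c / (12 * exp 1 * D)"
  have \<delta>: "\<delta> > 0" using c D by (simp add: \<delta>_def)
  have "\<exists>K :: (nat \<Rightarrow> real) set. convex_body n K \<and> symmetric_set K \<and>
        (\<forall>\<theta>. unit_vector n \<theta> \<longrightarrow>
          hyperplane_vol n \<theta> (proj n \<theta> ` K)
            \<ge> \<delta> * sqrt (real n) * vol n K powr ((real n - 1) / real n))" if n: "n \<ge> 1" for n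
  proof -
    define m where "m = k * n"
    have m: "m \<ge> 1" using k n by (simp add: m_def)
    obtain u where u: "\<And>x. c * real m * L2_set x {..<n} \<le> slab_sum n m u x"
      "\<And>x. slab_sum n m u x \<le> real 16 * real m * L2_set x {..<n}"
      using system n unfolding m_def by (metis of_nat_numeral)
    have a: "c * real m > 0" using c m by simp
    let ?V = "\<lambda>h. vol n (slab_body n m u h)"
    let ?r = "1 / (exp 1 * D * sqrt (real n))"
    have r: "?r > 0" using D n by simp
    have "(2 / sqrt (real n)) ^ n \<le> (3 * 2 ^ (16 + 1)) ^ m * ?V (\<lambda>_. 1)"
      by (rule vol_unit_slab_body_ge[OF n a u])
    also have "(3 * 2 ^ (16 + 1) :: real) ^ m = D ^ n"
      unfolding D_def m_def by (rule power_mult)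
    finally have V1: "(2 / sqrt (real n)) ^ n \<le> D ^ n * ?V (\<lambda>_. 1)" .
    have "(2 / sqrt (real n)) ^ n > 0" using n by simp
    then have V1_pos: "?V (\<lambda>_. 1) > 0"
      using V1 D by (metis less_le_trans zero_less_mult_pos zero_less_power zero_less_one)
    have "\<exists>h. (\<forall>i<m. h i > 0) \<and> (\<Sum>i<m. h i) \<le> real m \<and>
        (\<forall>g. (\<Sum>i<m. g i) \<le> real m \<longrightarrow> ?V g \<le> 2 * exp 1 * ?V h)"
      by (rule exists_near_maximal_slab_body[OF a u(1) n m V1_pos])
    then obtain h where h: "\<And>i. i < m \<Longrightarrow> h i > 0" "(\<Sum>i<m. h i) \<le> real m"
      "\<And>g. (\<Sum>i<m. g i) \<le> real m \<Longrightarrow> ?V g \<le> 2 * exp 1 * ?V h"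
      by auto
    have "?r ^ n \<le> ?V h"
    proof -
      have "(2 / sqrt (real n)) ^ n \<le> D ^ n * (2 * exp 1 * ?V h)"
        using D by (intro order_trans[OF V1] mult_left_mono h(3)) auto
      \<comment> \<open>A constant factor in the volume is absorbed into the \<open>n\<close>-th power of a constant.\<close>
      also have "2 * exp (1::real) \<le> (2 * exp 1) ^ n"
        using n self_le_power[of "2 * exp (1::real)" n] exp_ge_add_one_self[of "1::real"] by simp
      finally have "(2 / sqrt (real n)) ^ n \<le> D ^ n * ((2 * exp 1) ^ n * ?V h)"
        using D by (simp add: mult_left_mono mult_right_mono vol_def)
      then have "(2 / sqrt (real n)) ^ n \<le> (D * (2 * exp 1)) ^ n * ?V h"
        by (simp only: power_mult_distrib mult.assoc)
      then have "(2 / sqrt (real n)) ^ n / (D * (2 * exp 1)) ^ n \<le> ?V h"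
        using D by (subst pos_divide_le_eq) (auto simp: mult.commute)
      moreover have "2 / sqrt (real n) / (D * (2 * exp 1)) = ?r" by simp
      ultimately show ?thesis by (simp only: power_divide[symmetric])
    qed
    then have V_pos: "?V h > 0" using r by (meson less_le_trans zero_less_power)
    have "?r = (?r ^ n) powr (1 / real n)"
      using r n by (simp add: powr_powr flip: powr_realpow)
    also have "\<dots> \<le> ?V h powr (1 / real n)"
      using \<open>?r ^ n \<le> ?V h\<close> r by (intro powr_mono2) auto
    finally have root: "?r \<le> ?V h powr (1 / real n)" .
    have "\<delta> * sqrt (real n) * ?V h powr ((real n - 1) / real n)
        \<le> hyperplane_vol n \<theta> (proj n \<theta> ` slab_body n m u h)" if \<theta>: "unit_vector n \<theta>" for \<theta>
    proof -
      have "\<delta> * sqrt (real n) = c * real n / 12 * ?r"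
        using n D by (simp add: \<delta>_def field_simps)
      then have "\<delta> * sqrt (real n) * ?V h powr ((real n - 1) / real n)
          \<le> c * real n / 12 * ?V h powr (1 / real n) * ?V h powr ((real n - 1) / real n)"
        using root c by (simp only:) (intro mult_right_mono mult_left_mono, auto)
      also have "\<dots> = c * real n / 12 * ?V h"
      proof -
        have "?V h powr (1 / real n) * ?V h powr ((real n - 1) / real n) = ?V h powr 1"
          using n by (simp add: field_simps flip: powr_add add_divide_distrib)
        then show ?thesis using V_pos by (simp add: mult.assoc)
      qed
      also have "\<dots> \<le> hyperplane_vol n \<theta> (proj n \<theta> ` slab_body n m u h)"
        by (rule near_maximal_slab_body_shadow[OF n m c u(1) h(2,3) \<theta>])
      finally show ?thesis .
    qed
    moreover have "convex_body n (slab_body n m u h)"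
      by (rule convex_body_slab_body[OF a u(1) h(1)])
    ultimately show ?thesis using symmetric_set_slab_body by blast
  qed
  then show ?thesis using \<delta> by blast
qed

end
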